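(* For any positive integers $t,s$ with $ts=n$, there is an $[nt,s]$-scheme for counting the number of connected components of an input graph on $n$ vertices.
   Context: Annotated streaming model (schemes): a space-bounded Verifier reads an input stream $\sigma$ (here the edges of an undirected graph on vertex set $[n]$); after the stream ends, an all-powerful Prover sends a help message to the Verifier as a stream. A scheme for a function $f$ consists of the Verifier's randomized streaming algorithm, the honest Prover's help function, and the Verifier's output procedure, outputting a value in $\mathrm{range}(f)\cup\{\bot\}$ ($\bot$ = reject), with perfect completeness (honest help makes the Verifier output $f(\sigma)$ with probability 1) and soundness error at most $1/3$ (for every $\sigma$ and every help message, the probability of outputting a value outside $\{f(\sigma),\bot\}$ is at most $1/3$). An $[h,v]$-scheme uses $\tilde{O}(h)$ bits of help and $\tilde{O}(v)$ bits of Verifier space, where $\tilde{O}$ hides factors polynomial in $\log n$. Here $f$ is the number of connected components of the graph. *)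

theory Defs
  imports "HOL-Probability.Probability"
begin

text \<open>Edges of an undirected graph on vertex set [n] = {0..<n} are encoded canonically
  as pairs (u,v) with u < v < n. A valid input stream is a list of distinct such edges
  (each edge of the graph appears exactly once, in arbitrary order).\<close>

definition valid_stream :: "nat \<Rightarrow> (nat \<times> nat) list \<Rightarrow> bool" where
  "valid_stream n \<sigma> \<longleftrightarrow> distinct \<sigma> \<and> (\<forall>(u,v)\<in>set \<sigma>. u < v \<and> v < n)"

text \<open>Connectivity relation on [n] induced by the edges of the stream.\<close>
definition conn_rel :: "nat \<Rightarrow> (nat \<times> nat) list \<Rightarrow> (nat \<times> nat) set" where
  "conn_rel n \<sigma> = ((set \<sigma> \<union> (set \<sigma>)\<inverse>)\<^sup>*) \<inter> ({0..<n} \<times> {0..<n})"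

text \<open>Number of connected components of the graph on [n] with edge stream sigma.\<close>
definition num_components :: "nat \<Rightarrow> (nat \<times> nat) list \<Rightarrow> nat" where
  "num_components n \<sigma> = card ({0..<n} // conn_rel n \<sigma>)"

text \<open>Running a randomized streaming algorithm (state transitions are distributions).\<close>
fun run_stream :: "('s \<Rightarrow> 'a \<Rightarrow> 's pmf) \<Rightarrow> 's pmf \<Rightarrow> 'a list \<Rightarrow> 's pmf" where
  "run_stream step p [] = p"
| "run_stream step p (a # as) = run_stream step (bind_pmf p (\<lambda>x. step x a)) as"

text \<open>A scheme: the Verifier's memory is a bit string; it has a random initial state,
  randomized transitions on input tokens (edges) and on help tokens (bits), and a randomized
  output procedure (None = reject). The honest Prover maps the input stream to a help bit string.\<close>
record scheme =
  v_init :: "bool list pmf"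
  v_step :: "bool list \<Rightarrow> nat \<times> nat \<Rightarrow> bool list pmf"
  v_hstep :: "bool list \<Rightarrow> bool \<Rightarrow> bool list pmf"
  v_out :: "bool list \<Rightarrow> nat option pmf"
  p_help :: "(nat \<times> nat) list \<Rightarrow> bool list"

definition verifier_output :: "scheme \<Rightarrow> (nat \<times> nat) list \<Rightarrow> bool list \<Rightarrow> nat option pmf" where
  "verifier_output V \<sigma> \<eta> =
     bind_pmf (run_stream (v_hstep V) (run_stream (v_step V) (v_init V) \<sigma>) \<eta>) (v_out V)"

text \<open>V is a scheme for f on graphs with n vertices, using at most H help bits and at most
  S bits of Verifier memory (the memory never exceeds S bits, whatever the input).\<close>
definition is_scheme :: "nat \<Rightarrow> ((nat \<times> nat) list \<Rightarrow> nat) \<Rightarrow> real \<Rightarrow> real \<Rightarrow> scheme \<Rightarrow> bool" where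
  "is_scheme n f H S V \<longleftrightarrow>
     (\<forall>x\<in>set_pmf (v_init V). real (length x) \<le> S) \<and>
     (\<forall>x e. real (length x) \<le> S \<longrightarrow> (\<forall>y\<in>set_pmf (v_step V x e). real (length y) \<le> S)) \<and>
     (\<forall>x b. real (length x) \<le> S \<longrightarrow> (\<forall>y\<in>set_pmf (v_hstep V x b). real (length y) \<le> S)) \<and>
     (\<forall>\<sigma>. valid_stream n \<sigma> \<longrightarrow> real (length (p_help V \<sigma>)) \<le> H) \<and>
     (\<forall>\<sigma>. valid_stream n \<sigma> \<longrightarrow> verifier_output V \<sigma> (p_help V \<sigma>) = return_pmf (Some (f \<sigma>))) \<and>
     (\<forall>\<sigma> \<eta>. valid_stream n \<sigma> \<longrightarrow>
        measure_pmf.prob (verifier_output V \<sigma> \<eta>) {r. r \<noteq> Some (f \<sigma>) \<and> r \<noteq> None} \<le> 1/3)"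

end

theory Submission
  imports Defs "HOL-Number_Theory.Cong"
begin

text \<open>The Prover certifies the number of components by a spanning forest: for every vertex it sends
  a parent (the vertex itself for a root), the root of its component as a label, and the size of its
  subtree. Edges joining vertices with different labels are excluded and parent edges are counted by
  a single quadratic expression, a sum over the adjacency matrix, whose value is the number of
  non-roots exactly for correct data.  The recursion for the subtree sizes rules out cycles and is
  tested by evaluating a polynomial at a random point.

  For the sum over the adjacency matrix, vertex \<open>v\<close> is split as \<open>v = a * s + b\<close>.  The \<open>n * t\<close> pairs
  \<open>(u, a)\<close> become exponents of a variable and \<open>b < s\<close> remains an index: the sum is the coefficient at
  a fixed position of a polynomial of degree below \<open>4 * n * t\<close>, namely of a sum of \<open>s\<close> products, each of
  which the Verifier can evaluate at a secret random point modulo a prime of size \<open>n ^ O(1)\<close> with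
  \<open>O(s)\<close> registers.  The Prover sends the remaining coefficients.\<close>

section \<open>A prime of polynomial size and root counting modulo a prime\<close>

text \<open>The edges are gone before any label arrives, so no edge can be checked on its own. What
  remains possible is a pairing of an edge-side sum with a help-side sum, each linear in what is
  being read, multiplied only at the end. Multiplying sums over pairs (u, a) also produces all cross
  terms between different pairs. Complementary exponents put the matching terms, and only those, on
  one power of the variable; the coefficients sent by the Prover collect the cross terms, and false
  values there alone are harmless.

  One equation enforces two conditions because both errors have the same sign: a missing parent edge
  and an edge with different labels each lower the sum, so nothing cancels over the integers. The
  deficit is at most n + n^4, so modulo a prime above 16 * n^4 it is zero only if it is zero. The
  same prime exceeds three times the degree bound 4 * n * t, whence the error 1/3. Honest data
  satisfy the identities at every point, so they are accepted for every seed.\<close>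

lemma leibniz_triangle_dvd:
  fixes M :: nat
  assumes "\<And>i. 1 \<le> i \<Longrightarrow> i \<le> Suc n \<Longrightarrow> i dvd M" and "k \<le> n"
  shows "Suc n * (n choose k) dvd M"
  using assms
proof (induction k arbitrary: n)
  case 0
  then show ?case by simp
next
  case (Suc k)
  then obtain m where n: "n = Suc m" by (cases n) auto
  define x y z where "x = Suc n * (n choose Suc k)" and "y = Suc n * (n choose k)"
    and "z = Suc m * (m choose k)"
  have "y dvd M" unfolding y_def using Suc by (intro Suc.IH) auto
  then obtain y' where y': "M = y * y'" by blast
  have "z dvd M" unfolding z_def using Suc n by (intro Suc.IH) auto
  then obtain z' where z': "M = z * z'" by blast
  have y_pos: "y > 0" and z_pos: "z > 0"
    using Suc.prems n by (auto simp: y_def z_def)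
  have zx: "z = Suc k * (n choose Suc k)"
    unfolding z_def n using Suc_times_binomial_eq[of m k] by (simp add: algebra_simps)
  have zy: "z = (n - k) * (n choose k)"
    using Suc_times_binomial_add[of k "m - k"] Suc.prems n zx
      binomial_absorb_comp[of n k] by (simp add: z_def)
  \<comment> \<open>Here \<open>x\<close>, \<open>y\<close>, \<open>z\<close> are denominators in
    Leibniz's harmonic triangle, and this is its rule 1/x = 1/z - 1/y cleared of fractions. Hence
    M/x = M/z - M/y is an integer.\<close>
  have harmonic: "int y * int z = int x * (int y - int z)"
  proof -
    have "int y - int z = int (Suc k) * int (n choose k)"
      unfolding zy y_def using Suc.prems by (simp add: algebra_simps of_nat_diff)
    then have "int x * (int y - int z) = int x * (int (Suc k) * int (n choose k))" by (rule arg_cong)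
    also have "\<dots> = int y * int z" unfolding x_def zx y_def by (simp only: of_nat_mult ac_simps)
    finally show ?thesis by (rule sym)
  qed
  have "int y * int z * (int x * (int z' - int y')) = int x * (int y * (int z * int z') - int z * (int y * int y'))"
    by (simp add: algebra_simps)
  also have "\<dots> = int M * (int x * (int y - int z))"
    unfolding of_nat_mult[symmetric] y'[symmetric] z'[symmetric] by (simp add: algebra_simps)
  also have "\<dots> = int y * int z * int M" unfolding harmonic[symmetric] by simp
  finally have "int x * (int z' - int y') = int M" using y_pos z_pos by simp
  then have "int x dvd int M" by (metis dvd_triv_left)
  then have "x dvd M" by (simp only: int_dvd_int_iff)
  then show ?case by (simp only: x_def)
qed

text \<open>The n + 1 numbers (n + 1) * (n choose k) all divide M, and their average is 2 ^
  n.\<close>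

lemma two_power_le_common_multiple:
  fixes M :: nat
  assumes "\<And>i. 1 \<le> i \<Longrightarrow> i \<le> Suc n \<Longrightarrow> i dvd M" and "M > 0"
  shows "2 ^ n \<le> M"
proof -
  have "Suc n * 2 ^ n = (\<Sum>k\<le>n. Suc n * (n choose k))"
    by (simp only: choose_row_sum[symmetric] sum_distrib_left)
  also have "\<dots> \<le> (\<Sum>k\<le>n. M)"
  proof (rule sum_mono)
    fix k assume "k \<in> {..n}"
    then show "Suc n * (n choose k) \<le> M"
      using leibniz_triangle_dvd[of n M k] assms by (intro dvd_imp_le) auto
  qed
  also have "\<dots> = Suc n * M" by simp
  finally show ?thesis by (simp only: mult_le_cancel1)
qed

text \<open>The least common multiple of 1..n has one factor for each prime up to n, namely its
  largest power not exceeding n. Few primes therefore force a small multiple, against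
  \<open>two_power_le_common_multiple\<close>.\<close>

lemma common_multiple_le_power:
  assumes "n \<ge> 1" and no_prime: "\<And>p. prime p \<Longrightarrow> p \<le> n \<Longrightarrow> p \<le> N"
  shows "\<exists>M::nat. M > 0 \<and> M \<le> n ^ N \<and> (\<forall>i. 1 \<le> i \<and> i \<le> n \<longrightarrow> i dvd M)"
proof -
  define P where "P = {p::nat. prime p \<and> p \<le> N}"
  define e where "e p = (GREATEST j. p ^ j \<le> n)" for p
  have bound: "\<forall>j. p ^ j \<le> n \<longrightarrow> j \<le> n" if "prime p" for p :: nat
    using power_gt_expt[of p] prime_gt_1_nat[OF that] by (metis One_nat_def less_imp_le order_trans)
  have e: "p ^ e p \<le> n" if "prime p" for p
    unfolding e_def
    by (rule GreatestI_nat[of "\<lambda>j. p ^ j \<le> n" 0 n]) (use assms(1) bound[OF that] in simp_all)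
  have e_max: "j \<le> e p" if "prime p" "p ^ j \<le> n" for p j
    unfolding e_def by (rule Greatest_le_nat[of "\<lambda>j. p ^ j \<le> n" _ n]) (use that bound[OF that(1)] in simp_all)
  have fin: "finite P" unfolding P_def by simp
  have "P \<subseteq> {1..N}" unfolding P_def using prime_ge_1_nat by auto
  then have card: "card P \<le> N" using card_mono[of "{1..N}" P] by simp
  define M where "M = (\<Prod>p\<in>P. p ^ e p)"
  have "M > 0" unfolding M_def by (rule prod_pos) (auto simp: P_def prime_gt_0_nat)
  moreover have "M \<le> n ^ N"
  proof -
    have "M \<le> (\<Prod>p\<in>P. n)" unfolding M_def by (rule prod_mono) (auto simp: P_def e)
    also have "\<dots> \<le> n ^ N" using card assms by (simp add: power_increasing)
    finally show ?thesis .
  qed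
  moreover have "i dvd M" if i: "1 \<le> i" "i \<le> n" for i
  proof -
    have i_pow: "p ^ multiplicity p i \<le> n" for p
      using dvd_imp_le[OF multiplicity_dvd[of p i]] i by linarith
    have "i = (\<Prod>p\<in>prime_factors i. p ^ multiplicity p i)"
      using prime_factorization_nat[of i] i by simp
    also have "\<dots> dvd (\<Prod>p\<in>P. p ^ multiplicity p i)"
    proof (rule prod_dvd_prod_subset[OF fin], rule subsetI)
      fix p assume p: "p \<in> prime_factors i"
      then have "p \<le> i" using dvd_imp_le[of p i] i by (auto simp: prime_factors_dvd)
      with p i no_prime show "p \<in> P" by (auto simp: P_def prime_factors_dvd)
    qed
    also have "\<dots> dvd M" unfolding M_def
      by (rule prod_dvd_prod) (auto simp: P_def intro!: le_imp_power_dvd e_max i_pow)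
    finally show ?thesis .
  qed
  ultimately show ?thesis by blast
qed

text \<open>A weak form of Bertrand's postulate, enough for a prime with O(log n) bits. Without such
  a prime, some common multiple of 1..N for N = 2 ^ (2 * k + 3) would be at least 2 ^ (N - 1) and at
  most N ^ (2 ^ k), while N - 1 = 8 * 4 ^ k - 1 exceeds (2 * k + 3) * 2 ^ k.\<close>

lemma ex_prime_between_powers_of_two:
  "\<exists>p::nat. prime p \<and> 2 ^ k < p \<and> p \<le> 2 ^ (2 * k + 3)"
proof (rule ccontr)
  assume neg: "\<not> ?thesis"
  then have "p \<le> 2 ^ k" if "prime p" "p \<le> 2 ^ (2 * k + 3)" for p :: nat
    using that not_less by blast
  from common_multiple_le_power[OF _ this] obtain M :: nat
    where M: "M > 0" "M \<le> (2 ^ (2 * k + 3)) ^ (2 ^ k)"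
      "\<forall>i. 1 \<le> i \<and> i \<le> 2 ^ (2 * k + 3) \<longrightarrow> i dvd M"
    by (metis one_le_numeral one_le_power)
  have "Suc (2 ^ (2 * k + 3) - 1) = 2 ^ (2 * k + 3)" by simp
  then have "2 ^ (2 ^ (2 * k + 3) - 1) \<le> M"
    using M by (intro two_power_le_common_multiple) presburger+
  also have "\<dots> \<le> 2 ^ ((2 * k + 3) * 2 ^ k)" using M(2) by (simp only: power_mult)
  finally have "2 ^ (2 * k + 3) - 1 \<le> (2 * k + 3) * (2::nat) ^ k"
    by (rule power_le_imp_le_exp[rotated]) simp
  moreover have "2 * k + 3 \<le> 4 * 2 ^ k" by (induction k) auto
  then have "(2 * k + 3) * 2 ^ k \<le> 4 * 2 ^ k * (2::nat) ^ k" by (rule mult_right_mono) simp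
  moreover have "2 ^ (2 * k + 3) = 8 * (2 ^ k * (2::nat) ^ k)"
    by (simp only: power_add mult_2) simp
  moreover have "(1::nat) \<le> 2 ^ k * 2 ^ k" by simp
  ultimately show False by linarith
qed

text \<open>Lagrange's bound, kept over the integers: one coefficient that survives modulo p is
  exactly what a failed check yields, and division by a monic linear factor stays integral.\<close>

lemma card_roots_mod_prime_le:
  fixes f :: "int poly" and p :: nat
  assumes "prime p" and "\<not> int p dvd coeff f j" and "degree f \<le> d"
  shows "card {r\<in>{..<p}. int p dvd poly f (int r)} \<le> d"
  using assms(2,3)
proof (induction d arbitrary: f j)
  case 0
  then obtain a where f: "f = [:a:]" by (auto elim: degree_eq_zeroE)
  then have "\<not> int p dvd a" using 0 by (cases j) auto
  then show ?case using f by simp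
next
  case (Suc d)
  show ?case
  proof (cases "\<exists>r0<p. int p dvd poly f (int r0)")
    case False
    then have "{r\<in>{..<p}. int p dvd poly f (int r)} = {}" by auto
    then show ?thesis by (simp only: card.empty)
  next
    case True
    then obtain r0 where r0: "r0 < p" "int p dvd poly f (int r0)" by blast
    define q where "q = synthetic_div f (int r0)"
    have f_eq: "f = [:- int r0, 1:] * q + [:poly f (int r0):]"
      unfolding q_def using synthetic_div_correct'[of "int r0" f] by simp
    have deg: "degree q \<le> d" unfolding q_def using Suc.prems by (simp add: degree_synthetic_div)
    \<comment> \<open>If p divided every coefficient of \<open>q\<close>, it would divide every
      coefficient of \<open>f\<close>, as it divides \<open>poly f (int r0)\<close>.\<close>
    have "\<exists>i. \<not> int p dvd coeff q i"
    proof (rule ccontr)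
      assume "\<not> ?thesis"
      then have all: "int p dvd coeff q i" for i by blast
      have "coeff f j = coeff ([:- int r0, 1:] * q + [:poly f (int r0):]) j"
        by (subst (1) f_eq) (rule refl)
      moreover have "int p dvd coeff ([:- int r0, 1:] * q + [:poly f (int r0):]) j"
        using all r0 by (auto simp: coeff_pCons split: nat.split)
      ultimately show False using Suc.prems by simp
    qed
    then obtain i where i: "\<not> int p dvd coeff q i" by blast
    have "{r\<in>{..<p}. int p dvd poly f (int r)} \<subseteq> insert r0 {r\<in>{..<p}. int p dvd poly q (int r)}"
    proof
      fix r assume r: "r \<in> {r\<in>{..<p}. int p dvd poly f (int r)}"
      have "poly f (int r) = (int r - int r0) * poly q (int r) + poly f (int r0)"
        by (subst f_eq) (simp add: algebra_simps)
      then have "int p dvd (int r - int r0) * poly q (int r)"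
        using r r0 by (simp add: dvd_add_left_iff)
      then have "int p dvd (int r - int r0) \<or> int p dvd poly q (int r)"
        using assms(1) by (simp add: prime_dvd_mult_iff)
      moreover have "r = r0" if "int p dvd (int r - int r0)"
        using zdvd_imp_le[of "int p" "int r - int r0"] zdvd_imp_le[of "int p" "int r0 - int r"]
          that r r0 dvd_diff_commute[of "int p" "int r" "int r0"]
        by (cases r r0 rule: linorder_cases) auto
      ultimately show "r \<in> insert r0 {r\<in>{..<p}. int p dvd poly q (int r)}" using r by auto
    qed
    then have "card {r\<in>{..<p}. int p dvd poly f (int r)}
        \<le> card (insert r0 {r\<in>{..<p}. int p dvd poly q (int r)})" by (intro card_mono) auto
    also have "\<dots> \<le> Suc (card {r\<in>{..<p}. int p dvd poly q (int r)})" by (rule card_insert_le_m1) auto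
    also have "\<dots> \<le> Suc d" using Suc.IH[OF i deg] by simp
    finally show ?thesis .
  qed
qed

section \<open>From finite machines to schemes\<close>

text \<open>With all randomness in the initial state, a run is an ordinary fold for each seed, and
  probabilities become counts of seeds.\<close>

lemma run_stream_deterministic:
  "run_stream (\<lambda>x a. return_pmf (g x a)) (map_pmf h q) xs = map_pmf (\<lambda>r. foldl g (h r) xs) q"
proof (induction xs arbitrary: h)
  case (Cons a xs)
  have "bind_pmf (map_pmf h q) (\<lambda>x. return_pmf (g x a)) = map_pmf (\<lambda>r. g (h r) a) q"
    by (simp add: map_pmf_def bind_assoc_pmf bind_return_pmf)
  then show ?case using Cons.IH[of "\<lambda>r. g (h r) a"] by simp
qed simp

lemma ex_bit_encoding:
  assumes "finite A" and "card A \<le> 2 ^ L"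
  shows "\<exists>enc :: 'a \<Rightarrow> bool list. inj_on enc A \<and> (\<forall>x\<in>A. length (enc x) = L)"
proof -
  let ?B = "{xs :: bool list. set xs \<subseteq> UNIV \<and> length xs = L}"
  have "card ?B = 2 ^ L"
    by (subst card_lists_length_eq) auto
  then have "card A \<le> card ?B" using assms(2) by simp
  from card_le_inj[OF assms(1) finite_lists_length_eq[OF finite_class.finite_UNIV] this]
  obtain enc :: "'a \<Rightarrow> bool list" where enc: "enc ` A \<subseteq> ?B \<and> inj_on enc A" ..
  have "length (enc x) = L" if "x \<in> A" for x using enc that by fast
  with enc show ?thesis by fast
qed

lemma foldl_closed:
  assumes closed: "\<And>q x. q \<in> Q \<Longrightarrow> g q x \<in> Q" and "q \<in> Q"
  shows "foldl g q xs \<in> Q"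
  using \<open>q \<in> Q\<close>
proof (induction xs arbitrary: q)
  case (Cons x xs)
  then show ?case using closed[OF Cons.prems, of x] by simp
qed simp

text \<open>\<open>is_scheme\<close> bounds the memory after a step from any short string, even one
  that encodes no state; leaving such strings fixed meets this demand.\<close>

definition encoded_step :: "'q set \<Rightarrow> ('q \<Rightarrow> bool list) \<Rightarrow> ('q \<Rightarrow> 'a \<Rightarrow> 'q) \<Rightarrow> bool list \<Rightarrow> 'a \<Rightarrow> bool list" where
  "encoded_step Q enc g x a = (if x \<in> enc ` Q then enc (g (inv_into Q enc x) a) else x)"

lemma foldl_encoded_step:
  assumes "inj_on enc Q" and "q \<in> Q" and "\<And>q x. q \<in> Q \<Longrightarrow> g q x \<in> Q"
  shows "foldl (encoded_step Q enc g) (enc q) xs = enc (foldl g q xs)"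
  using \<open>q \<in> Q\<close>
proof (induction xs arbitrary: q)
  case (Cons x xs)
  then show ?case using Cons.IH[OF assms(3)[OF Cons.prems, of x]] assms(1)
    by (simp add: encoded_step_def)
qed simp

lemma length_encoded_step:
  assumes "\<And>q. q \<in> Q \<Longrightarrow> length (enc q) = L" and "inj_on enc Q" and "\<And>q x. q \<in> Q \<Longrightarrow> g q x \<in> Q"
    and "length x \<le> S" and "L \<le> S"
  shows "length (encoded_step Q enc g x a) \<le> S"
proof (cases "x \<in> enc ` Q")
  case True
  then have "g (inv_into Q enc x) a \<in> Q" by (intro assms(3) inv_into_into)
  with True show ?thesis using assms(1,5) by (simp add: encoded_step_def)
qed (simp add: encoded_step_def assms(4))

text \<open>Whatever the machine has to remember of its uniform seed is part of the state, hence
  paid for by \<open>L\<close>. Soundness becomes a count of bad seeds.\<close>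

lemma scheme_of_finite_machine:
  fixes Q :: "'q set" and R :: "'r set"
    and step :: "'q \<Rightarrow> nat \<times> nat \<Rightarrow> 'q" and hstep :: "'q \<Rightarrow> bool \<Rightarrow> 'q"
  assumes Q: "finite Q" "card Q \<le> 2 ^ L" "real L \<le> S"
    and R: "finite R" "R \<noteq> {}"
    and init: "\<And>r. r \<in> R \<Longrightarrow> init r \<in> Q"
    and step: "\<And>q e. q \<in> Q \<Longrightarrow> step q e \<in> Q"
    and hstep: "\<And>q b. q \<in> Q \<Longrightarrow> hstep q b \<in> Q"
    and honest_length: "\<And>\<sigma>. valid_stream n \<sigma> \<Longrightarrow> real (length (honest \<sigma>)) \<le> H"
    and complete: "\<And>\<sigma> r. valid_stream n \<sigma> \<Longrightarrow> r \<in> R \<Longrightarrow>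
      out (foldl hstep (foldl step (init r) \<sigma>) (honest \<sigma>)) = Some (f \<sigma>)"
    and sound: "\<And>\<sigma> \<eta>. valid_stream n \<sigma> \<Longrightarrow>
      3 * card {r\<in>R. out (foldl hstep (foldl step (init r) \<sigma>) \<eta>) \<notin> {None, Some (f \<sigma>)}} \<le> card R"
  shows "\<exists>V. is_scheme n f H S V"
proof -
  obtain enc :: "'q \<Rightarrow> bool list" where enc: "inj_on enc Q" "\<And>q. q \<in> Q \<Longrightarrow> length (enc q) = L"
    using ex_bit_encoding[OF Q(1,2)] by blast
  let ?es = "encoded_step Q enc step" and ?eh = "encoded_step Q enc hstep"
  define V where "V = \<lparr>v_init = map_pmf (enc \<circ> init) (pmf_of_set R),
    v_step = (\<lambda>x e. return_pmf (?es x e)), v_hstep = (\<lambda>x b. return_pmf (?eh x b)),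
    v_out = (\<lambda>x. return_pmf (out (inv_into Q enc x))), p_help = honest\<rparr>"
  have fold_in: "foldl hstep (foldl step (init r) \<sigma>) \<eta> \<in> Q" if "r \<in> R" for r \<sigma> \<eta>
    using that by (intro foldl_closed hstep step init)
  have step_in: "foldl step (init r) \<sigma> \<in> Q" if "r \<in> R" for r \<sigma>
    using that by (intro foldl_closed step init)
  have out_eq: "verifier_output V \<sigma> \<eta>
      = map_pmf (\<lambda>r. out (foldl hstep (foldl step (init r) \<sigma>) \<eta>)) (pmf_of_set R)" for \<sigma> \<eta>
  proof -
    have "verifier_output V \<sigma> \<eta> = map_pmf (\<lambda>r. out (inv_into Q enc
        (foldl ?eh (foldl ?es ((enc \<circ> init) r) \<sigma>) \<eta>))) (pmf_of_set R)"
      unfolding verifier_output_def V_def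
      by (simp only: scheme.simps run_stream_deterministic)
        (simp add: map_pmf_def bind_assoc_pmf bind_return_pmf)
    also have "\<dots> = map_pmf (\<lambda>r. out (foldl hstep (foldl step (init r) \<sigma>) \<eta>)) (pmf_of_set R)"
    proof (rule map_pmf_cong[OF refl])
      fix r assume "r \<in> set_pmf (pmf_of_set R)"
      then have r: "r \<in> R" using R by simp
      have "foldl ?es (enc (init r)) \<sigma> = enc (foldl step (init r) \<sigma>)"
        by (rule foldl_encoded_step[OF enc(1) init[OF r] step])
      moreover have "foldl ?eh (enc (foldl step (init r) \<sigma>)) \<eta> = enc (foldl hstep (foldl step (init r) \<sigma>) \<eta>)"
        by (rule foldl_encoded_step[OF enc(1) step_in[OF r] hstep])
      ultimately show "out (inv_into Q enc (foldl ?eh (foldl ?es ((enc \<circ> init) r) \<sigma>) \<eta>))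
          = out (foldl hstep (foldl step (init r) \<sigma>) \<eta>)"
        using enc(1) fold_in[OF r] by simp
    qed
    finally show ?thesis .
  qed
  have S_nat: "real k \<le> S \<longleftrightarrow> k \<le> nat \<lfloor>S\<rfloor>" for k using Q(3) by linarith
  have LS: "L \<le> nat \<lfloor>S\<rfloor>" using Q(3) S_nat by simp
  have "is_scheme n f H S V"
    unfolding is_scheme_def
  proof (intro conjI allI impI ballI)
    fix x assume "x \<in> set_pmf (v_init V)"
    then show "real (length x) \<le> S" using R init enc Q(3) by (auto simp: V_def)
  next
    fix x e y assume "real (length x) \<le> S" "y \<in> set_pmf (v_step V x e)"
    then show "real (length y) \<le> S"
      using length_encoded_step[OF enc(2,1) step _ LS] by (simp add: V_def S_nat)
  next
    fix x b y assume "real (length x) \<le> S" "y \<in> set_pmf (v_hstep V x b)"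
    then show "real (length y) \<le> S"
      using length_encoded_step[OF enc(2,1) hstep _ LS] by (simp add: V_def S_nat)
  next
    fix \<sigma> assume \<sigma>: "valid_stream n \<sigma>"
    then show "real (length (p_help V \<sigma>)) \<le> H" using honest_length by (simp add: V_def)
    have "verifier_output V \<sigma> (p_help V \<sigma>) = map_pmf (\<lambda>r. Some (f \<sigma>)) (pmf_of_set R)"
      unfolding out_eq by (rule map_pmf_cong) (use complete[OF \<sigma>] R in \<open>auto simp: V_def\<close>)
    then show "verifier_output V \<sigma> (p_help V \<sigma>) = return_pmf (Some (f \<sigma>))" by simp
  next
    fix \<sigma> \<eta> assume \<sigma>: "valid_stream n \<sigma>"
    let ?B = "{r\<in>R. out (foldl hstep (foldl step (init r) \<sigma>) \<eta>) \<notin> {None, Some (f \<sigma>)}}"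
    have "measure_pmf.prob (verifier_output V \<sigma> \<eta>) {r. r \<noteq> Some (f \<sigma>) \<and> r \<noteq> None} = card ?B / card R"
      unfolding out_eq measure_map_pmf measure_pmf_of_set[OF R(2,1)]
      by (intro arg_cong2[where f="(/)"] arg_cong[where f=real] arg_cong[where f=card]) auto
    also have "\<dots> \<le> 1 / 3" using sound[OF \<sigma>, of \<eta>] R by (simp add: field_simps card_gt_0_iff)
    finally show "measure_pmf.prob (verifier_output V \<sigma> \<eta>) {r. r \<noteq> Some (f \<sigma>) \<and> r \<noteq> None} \<le> 1 / 3" .
  qed
  then show ?thesis by blast
qed

section \<open>Reading help bits as tokens of fixed length\<close>

definition buffered_step :: "nat \<Rightarrow> (bool list \<Rightarrow> 'x) \<Rightarrow> ('q \<Rightarrow> 'x \<Rightarrow> 'q) \<Rightarrow> 'q \<times> bool list \<Rightarrow> bool \<Rightarrow> 'q \<times> bool list" where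
  "buffered_step w dec g = (\<lambda>(q, buf) b.
     if Suc (length buf) = w then (g q (dec (buf @ [b])), []) else (q, buf @ [b]))"

lemma foldl_buffered_step_partial:
  assumes "length (buf @ bs) < w"
  shows "foldl (buffered_step w dec g) (q, buf) bs = (q, buf @ bs)"
  using assms by (induction bs arbitrary: buf) (auto simp: buffered_step_def)

lemma foldl_buffered_step_word:
  assumes "length bs = w" and "w > 0"
  shows "foldl (buffered_step w dec g) (q, []) bs = (g q (dec bs), [])"
proof -
  obtain b bs' where bs: "bs = bs' @ [b]" using assms by (cases bs rule: rev_cases) auto
  then show ?thesis
    using assms by (simp add: foldl_buffered_step_partial) (simp add: buffered_step_def)
qed

lemma foldl_buffered_step_concat:
  assumes "w > 0" and "\<And>x. x \<in> X \<Longrightarrow> length (enc x) = w \<and> dec (enc x) = x" and "set xs \<subseteq> X"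
  shows "foldl (buffered_step w dec g) (q, []) (concat (map enc xs)) = (foldl g q xs, [])"
  using assms(3)
proof (induction xs arbitrary: q)
  case (Cons x xs)
  then have "x \<in> X" "set xs \<subseteq> X" by simp_all
  then show ?case using Cons.IH assms by (simp add: foldl_buffered_step_word)
qed simp

text \<open>A cheating Prover may send arbitrary bits. As \<open>dec\<close> is total into
  \<open>X\<close>, they act as some list of legal tokens and an unfinished word. The list does not
  depend on the state \<open>q\<close>, hence not on the secret seed, so soundness against token
  lists carries over.\<close>

lemma foldl_buffered_step_parse:
  assumes "w > 0" and "\<And>bs. dec bs \<in> X"
  shows "\<exists>xs buf. set xs \<subseteq> X \<and> length buf < w \<and>
    (\<forall>q. foldl (buffered_step w dec g) (q, []) bs = (foldl g q xs, buf))"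
proof (induction bs rule: rev_induct)
  case Nil
  show ?case using assms by (intro exI[of _ "[]"]) simp
next
  case (snoc b bs)
  then obtain xs buf where IH: "set xs \<subseteq> X" "length buf < w"
    "\<forall>q. foldl (buffered_step w dec g) (q, []) bs = (foldl g q xs, buf)" by blast
  show ?case
  proof (cases "Suc (length buf) = w")
    case True
    then show ?thesis using IH assms
      by (intro exI[of _ "xs @ [dec (buf @ [b])]"] exI[of _ "[]"]) (simp add: buffered_step_def)
  next
    case False
    then show ?thesis using IH
      by (intro exI[of _ xs] exI[of _ "buf @ [b]"]) (simp add: buffered_step_def)
  qed
qed

lemma card_short_bit_lists:
  assumes "w > 0"
  shows "card {bs :: bool list. length bs < w} \<le> 2 ^ w" and "finite {bs :: bool list. length bs < w}"
proof -
  have eq: "{bs :: bool list. length bs < w} = {bs. set bs \<subseteq> UNIV \<and> length bs \<le> w - 1}"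
    using assms by auto
  show "finite {bs :: bool list. length bs < w}"
    unfolding eq by (rule finite_lists_length_le) simp
  have "card {bs :: bool list. length bs < w} = (\<Sum>i\<le>w - 1. 2 ^ i)"
    unfolding eq by (subst card_lists_length_le) auto
  also have "\<dots> = (\<Sum>i<w. 2 ^ i)"
    using assms by (intro sum.cong) auto
  also have "\<dots> \<le> 2 ^ w" by (induction w) auto
  finally show "card {bs :: bool list. length bs < w} \<le> 2 ^ w" .
qed

lemma scheme_of_token_machine:
  fixes Q :: "'q set" and R :: "'r set" and X :: "'x set"
    and step :: "'q \<Rightarrow> nat \<times> nat \<Rightarrow> 'q" and tstep :: "'q \<Rightarrow> 'x \<Rightarrow> 'q"
  assumes Q: "finite Q" "card Q \<le> 2 ^ L"
    and X: "finite X" "X \<noteq> {}" "card X \<le> 2 ^ w" "w > 0"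
    and S: "real (L + w) \<le> S"
    and R: "finite R" "R \<noteq> {}"
    and init: "\<And>r. r \<in> R \<Longrightarrow> init r \<in> Q"
    and step: "\<And>q e. q \<in> Q \<Longrightarrow> step q e \<in> Q"
    and tstep: "\<And>q x. q \<in> Q \<Longrightarrow> tstep q x \<in> Q"
    and honest: "\<And>\<sigma>. valid_stream n \<sigma> \<Longrightarrow> set (honest \<sigma>) \<subseteq> X \<and> real (length (honest \<sigma>) * w) \<le> H"
    and complete: "\<And>\<sigma> r. valid_stream n \<sigma> \<Longrightarrow> r \<in> R \<Longrightarrow>
      out (foldl tstep (foldl step (init r) \<sigma>) (honest \<sigma>)) = Some (f \<sigma>)"
    and sound: "\<And>\<sigma> \<tau>. valid_stream n \<sigma> \<Longrightarrow> set \<tau> \<subseteq> X \<Longrightarrow>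
      3 * card {r\<in>R. out (foldl tstep (foldl step (init r) \<sigma>) \<tau>) \<notin> {None, Some (f \<sigma>)}} \<le> card R"
  shows "\<exists>V. is_scheme n f H S V"
proof -
  obtain enc :: "'x \<Rightarrow> bool list" where enc: "inj_on enc X" "\<And>x. x \<in> X \<Longrightarrow> length (enc x) = w"
    using ex_bit_encoding[OF X(1,3)] by blast
  obtain x0 where x0: "x0 \<in> X" using X by blast
  \<comment> \<open>Words that encode no token are read as \<open>x0\<close>, so malformed help is
    merely different help.\<close>
  define dec where "dec bs = (if bs \<in> enc ` X then inv_into X enc bs else x0)" for bs
  have dec_in: "dec bs \<in> X" for bs by (simp add: dec_def x0 inv_into_into)
  have dec_enc: "dec (enc x) = x" if "x \<in> X" for x using that enc by (simp add: dec_def)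
  let ?B = "{bs :: bool list. length bs < w}"
  define estep where "estep = (\<lambda>(q, buf :: bool list) e. (step q e, buf))"
  have fold_estep: "foldl estep (q, buf) \<sigma> = (foldl step q \<sigma>, buf)" for q buf \<sigma>
    by (induction \<sigma> arbitrary: q) (simp_all add: estep_def)
  show ?thesis
  proof (rule scheme_of_finite_machine[where Q="Q \<times> ?B" and L="L + w" and R=R
        and init="\<lambda>r. (init r, [])" and step=estep and hstep="buffered_step w dec tstep"
        and honest="\<lambda>\<sigma>. concat (map enc (honest \<sigma>))" and out="out \<circ> fst"])
    show "finite (Q \<times> ?B)" using Q card_short_bit_lists(2)[OF X(4)] by simp
    show "card (Q \<times> ?B) \<le> 2 ^ (L + w)"
      unfolding card_cartesian_product power_add
      using Q(2) card_short_bit_lists(1)[OF X(4)] by (rule mult_le_mono)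
    show "real (L + w) \<le> S" "finite R" "R \<noteq> {}" by fact+
    show "(init r, []) \<in> Q \<times> ?B" if "r \<in> R" for r using init[OF that] X by simp
    show "estep q e \<in> Q \<times> ?B" if "q \<in> Q \<times> ?B" for q e using that step[of _ e] by (auto simp: estep_def)
    show "buffered_step w dec tstep q b \<in> Q \<times> ?B" if "q \<in> Q \<times> ?B" for q b
      using that tstep X(4) by (auto simp: buffered_step_def split: if_splits)
  next
    fix \<sigma> assume \<sigma>: "valid_stream n \<sigma>"
    have "length (concat (map enc xs)) = length xs * w" if "set xs \<subseteq> X" for xs
      using that enc(2) by (induction xs) auto
    then show "real (length (concat (map enc (honest \<sigma>)))) \<le> H" using honest[OF \<sigma>] by metis
    fix r assume "r \<in> R"
    then show "(out \<circ> fst) (foldl (buffered_step w dec tstep) (foldl estep (init r, []) \<sigma>)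
        (concat (map enc (honest \<sigma>)))) = Some (f \<sigma>)"
      using complete[OF \<sigma>] honest[OF \<sigma>] enc dec_enc X(4)
      by (simp add: fold_estep foldl_buffered_step_concat[where X=X])
  next
    fix \<sigma> \<eta> assume \<sigma>: "valid_stream n \<sigma>"
    obtain xs buf where "set xs \<subseteq> X"
      and "\<forall>q. foldl (buffered_step w dec tstep) (q, []) \<eta> = (foldl tstep q xs, buf)"
      using foldl_buffered_step_parse[of w dec X tstep \<eta>] X(4) dec_in by blast
    then show "3 * card {r\<in>R. (out \<circ> fst) (foldl (buffered_step w dec tstep)
        (foldl estep (init r, []) \<sigma>) \<eta>) \<notin> {None, Some (f \<sigma>)}} \<le> card R"
      using sound[OF \<sigma>, of xs] by (simp add: fold_estep)
  qed
qed

section \<open>Linear sums kept in registers modulo a prime\<close>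

definition register_value where
  "register_value p a h r \<sigma> \<tau> j =
     ((\<Sum>e\<leftarrow>\<sigma>. a j r e) + (\<Sum>i<length \<tau>. h j r i (\<tau> ! i))) mod int p"

text \<open>A state holds the seed, a token counter with T + 1 values and the registers. Seed and
  counter fit into b bits each because T < p \<le> 2 ^ b, which accounts for the + 2; the final
  \<open>w\<close> is for the word being read.\<close>

lemma scheme_of_linear_registers:
  fixes X :: "'x set" and J :: "'j set" and p w b T :: nat
    and a :: "'j \<Rightarrow> nat \<Rightarrow> nat \<times> nat \<Rightarrow> int" and h :: "'j \<Rightarrow> nat \<Rightarrow> nat \<Rightarrow> 'x \<Rightarrow> int"
  assumes J: "finite J" "card J \<le> m"
    and p: "T < p" "p \<le> 2 ^ b"
    and X: "finite X" "X \<noteq> {}" "card X \<le> 2 ^ w" "w > 0"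
    and S: "real (b * (m + 2) + w) \<le> S"
    and outside: "\<And>j r e. j \<notin> J \<Longrightarrow> a j r e = 0" "\<And>j r i x. j \<notin> J \<Longrightarrow> h j r i x = 0"
    and late: "\<And>j r i x. T \<le> i \<Longrightarrow> h j r i x = 0"
    and honest: "\<And>\<sigma>. valid_stream n \<sigma> \<Longrightarrow>
      set (honest \<sigma>) \<subseteq> X \<and> length (honest \<sigma>) = T \<and> real (length (honest \<sigma>) * w) \<le> H"
    and complete: "\<And>\<sigma> r. valid_stream n \<sigma> \<Longrightarrow> r < p \<Longrightarrow>
      out r (register_value p a h r \<sigma> (honest \<sigma>)) = Some (f \<sigma>)"
    and sound: "\<And>\<sigma> \<tau>. valid_stream n \<sigma> \<Longrightarrow> set \<tau> \<subseteq> X \<Longrightarrow> T \<le> length \<tau> \<Longrightarrow>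
      3 * card {r\<in>{..<p}. out r (register_value p a h r \<sigma> \<tau>) \<notin> {None, Some (f \<sigma>)}} \<le> p"
  shows "\<exists>V. is_scheme n f H S V"
proof -
  \<comment> \<open>The default 0 outside \<open>J\<close> keeps the set of states finite although
    register contents are functions on the whole type.\<close>
  define F where "F = PiE_dflt J 0 (\<lambda>_. {0..<int p})"
  have F_iff: "g \<in> F \<longleftrightarrow> (\<forall>j. 0 \<le> g j \<and> g j < int p) \<and> (\<forall>j. j \<notin> J \<longrightarrow> g j = 0)" for g
  proof -
    have "(j \<in> J \<longrightarrow> g j \<in> {0..<int p}) \<and> (j \<notin> J \<longrightarrow> g j = 0) \<longleftrightarrow>
        (0 \<le> g j \<and> g j < int p) \<and> (j \<notin> J \<longrightarrow> g j = 0)" for j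
      using p(1) by auto
    then show ?thesis unfolding F_def PiE_dflt_def mem_Collect_eq all_conj_distrib[symmetric] by simp
  qed
  have "finite F" unfolding F_def using J by (intro finite_PiE_dflt) auto
  have "card F = p ^ card J" unfolding F_def using J by (subst card_PiE_dflt) auto
  also have "\<dots> \<le> p ^ m" using J p by (intro power_increasing) auto
  also have "\<dots> \<le> (2 ^ b) ^ m" using p by (intro power_mono) auto
  finally have card_F: "card F \<le> (2 ^ b) ^ m" .
  let ?Q = "{..<p} \<times> {..T} \<times> F"
  define step where "step = (\<lambda>(r, i :: nat, g) e. (r, i, \<lambda>j. (g j + a j r e) mod int p))"
  \<comment> \<open>The counter saturates at \<open>T\<close>. Help weights vanish from index
    \<open>T\<close> on, so the saturated index gives the same contribution 0 as the true
    one.\<close>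
  define tstep where "tstep = (\<lambda>(r, i, g) x. (r, min (Suc i) T, \<lambda>j. (g j + h j r i x) mod int p))"
  \<comment> \<open>Rejecting help that breaks off early leaves soundness to be shown only for lists
    of at least \<open>T\<close> tokens.\<close>
  define out' where "out' = (\<lambda>(r, i, g). if i = T then out r g else None)"
  have fold_step: "foldl step (r, 0, \<lambda>_. 0) \<sigma> = (r, 0, register_value p a h r \<sigma> [])" for r \<sigma>
    by (induction \<sigma> rule: rev_induct) (auto simp: step_def register_value_def mod_add_left_eq)
  have fold_tstep: "foldl tstep (r, 0, register_value p a h r \<sigma> []) \<tau>
      = (r, min (length \<tau>) T, register_value p a h r \<sigma> \<tau>)" for r \<sigma> \<tau>
  proof (induction \<tau> rule: rev_induct)
    case (snoc x \<tau>)
    have "(register_value p a h r \<sigma> \<tau> j + h j r (min (length \<tau>) T) x) mod int p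
        = register_value p a h r \<sigma> (\<tau> @ [x]) j" for j
    proof -
      have "h j r (min (length \<tau>) T) x = h j r (length \<tau>) x" by (simp add: min_def late)
      moreover have "(\<Sum>i<length \<tau>. h j r i ((\<tau> @ [x]) ! i)) = (\<Sum>i<length \<tau>. h j r i (\<tau> ! i))"
        by (intro sum.cong) (auto simp: nth_append)
      ultimately show ?thesis by (simp add: register_value_def mod_add_left_eq add.assoc)
    qed
    with snoc show ?case by (simp add: tstep_def)
  qed simp
  show ?thesis
  proof (rule scheme_of_token_machine[where Q="?Q" and L="b * (m + 2)" and X=X and w=w
        and R="{..<p}" and init="\<lambda>r. (r, 0, \<lambda>_. 0)" and step=step and tstep=tstep and honest=honest
        and out=out'])
    show "finite ?Q" using \<open>finite F\<close> by simp
    have "card ?Q = p * (Suc T * card F)" by (simp add: card_cartesian_product)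
    also have "\<dots> \<le> 2 ^ b * (2 ^ b * (2 ^ b) ^ m)"
      using p card_F by (intro mult_le_mono) auto
    also have "\<dots> = 2 ^ (b * (m + 2))" by (simp add: power_mult[symmetric] power_add[symmetric] algebra_simps)
    finally show "card ?Q \<le> 2 ^ (b * (m + 2))" .
    show "finite X" "X \<noteq> {}" "card X \<le> 2 ^ w" "w > 0" "real (b * (m + 2) + w) \<le> S" by fact+
    show "finite {..<p}" "{..<p} \<noteq> {}" using p by auto
    show "(r, 0, \<lambda>_. 0) \<in> ?Q" if "r \<in> {..<p}" for r using that p by (auto simp: F_iff)
    show "step q e \<in> ?Q" if "q \<in> ?Q" for q e
      using that p by (auto simp: step_def F_iff outside)
    show "tstep q x \<in> ?Q" if "q \<in> ?Q" for q x
      using that p by (auto simp: tstep_def F_iff outside)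
    show "set (honest \<sigma>) \<subseteq> X \<and> real (length (honest \<sigma>) * w) \<le> H" if "valid_stream n \<sigma>" for \<sigma>
      using honest[OF that] by blast
    show "out' (foldl tstep (foldl step (r, 0, \<lambda>_. 0) \<sigma>) (honest \<sigma>)) = Some (f \<sigma>)"
      if "valid_stream n \<sigma>" "r \<in> {..<p}" for \<sigma> r
      using that honest complete by (simp add: fold_step fold_tstep out'_def)
    show "3 * card {r \<in> {..<p}. out' (foldl tstep (foldl step (r, 0, \<lambda>_. 0) \<sigma>) \<tau>) \<notin> {None, Some (f \<sigma>)}}
        \<le> card {..<p}" if "valid_stream n \<sigma>" "set \<tau> \<subseteq> X" for \<sigma> \<tau>
    proof (cases "T \<le> length \<tau>")
      case True
      then show ?thesis using sound[OF that True] by (simp add: fold_step fold_tstep out'_def)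
    next
      case False
      then show ?thesis by (simp add: fold_step fold_tstep out'_def)
    qed
  qed
qed

section \<open>Forests certifying the number of components\<close>

definition adj :: "(nat \<times> nat) list \<Rightarrow> (nat \<times> nat) set" where
  "adj \<sigma> = set \<sigma> \<union> (set \<sigma>)\<inverse>"

lemma sym_adj: "sym (adj \<sigma>)"
  unfolding adj_def by (rule sym_Un_converse)

lemma adj_bound: "valid_stream n \<sigma> \<Longrightarrow> (u, v) \<in> adj \<sigma> \<Longrightarrow> u < n \<and> v < n \<and> u \<noteq> v"
  unfolding adj_def valid_stream_def by fastforce

lemma finite_adj [simp]: "finite (adj \<sigma>)"
  unfolding adj_def by simp

lemma rtrancl_adj_bound: "valid_stream n \<sigma> \<Longrightarrow> (u, v) \<in> (adj \<sigma>)\<^sup>* \<Longrightarrow> u < n \<Longrightarrow> v < n"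
  by (erule rtrancl_induct) (auto dest: adj_bound)

lemma conn_rel_eq: "conn_rel n \<sigma> = (adj \<sigma>)\<^sup>* \<inter> ({0..<n} \<times> {0..<n})"
  unfolding conn_rel_def adj_def ..

lemma equiv_conn_rel: "equiv {0..<n} (conn_rel n \<sigma>)"
proof (rule equivI)
  show "conn_rel n \<sigma> \<subseteq> {0..<n} \<times> {0..<n}" unfolding conn_rel_eq by blast
  show "refl_on {0..<n} (conn_rel n \<sigma>)" unfolding conn_rel_eq by (auto simp: refl_on_def)
  show "sym (conn_rel n \<sigma>)"
    unfolding conn_rel_eq using sym_rtrancl[OF sym_adj[of \<sigma>]] by (auto simp: sym_def)
  show "trans (conn_rel n \<sigma>)" unfolding conn_rel_eq by (auto simp: trans_def intro: rtrancl_trans)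
qed

lemma num_components_eq_card:
  assumes R: "R \<subseteq> {0..<n}"
    and reach: "\<And>u. u < n \<Longrightarrow> \<exists>r\<in>R. (u, r) \<in> (adj \<sigma>)\<^sup>*"
    and separate: "\<And>r r'. r \<in> R \<Longrightarrow> r' \<in> R \<Longrightarrow> (r, r') \<in> (adj \<sigma>)\<^sup>* \<Longrightarrow> r = r'"
  shows "num_components n \<sigma> = card R"
proof -
  let ?c = "conn_rel n \<sigma>"
  have "bij_betw (\<lambda>r. ?c `` {r}) R ({0..<n} // ?c)"
    unfolding bij_betw_def
  proof
    show "inj_on (\<lambda>r. ?c `` {r}) R"
    proof (rule inj_onI)
      fix r r' assume r: "r \<in> R" "r' \<in> R" and "?c `` {r} = ?c `` {r'}"
      then have "(r, r') \<in> ?c" using equiv_conn_rel R by (meson eq_equiv_class subsetD)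
      then show "r = r'" using separate r by (simp add: conn_rel_eq)
    qed
    show "(\<lambda>r. ?c `` {r}) ` R = {0..<n} // ?c"
    proof
      show "(\<lambda>r. ?c `` {r}) ` R \<subseteq> {0..<n} // ?c" using R by (auto intro: quotientI)
      show "{0..<n} // ?c \<subseteq> (\<lambda>r. ?c `` {r}) ` R"
      proof
        fix A assume "A \<in> {0..<n} // ?c"
        then obtain u where u: "u < n" "A = ?c `` {u}" by (auto elim: quotientE)
        with reach obtain r where r: "r \<in> R" "(u, r) \<in> (adj \<sigma>)\<^sup>*" by blast
        then have "(u, r) \<in> ?c" using u R by (auto simp: conn_rel_eq)
        then have "A = ?c `` {r}" using u(2) equiv_class_eq[OF equiv_conn_rel] by blast
        with r show "A \<in> (\<lambda>r. ?c `` {r}) ` R" by blast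
      qed
    qed
  qed
  then show ?thesis unfolding num_components_def by (rule bij_betw_same_card[symmetric])
qed

section \<open>Rooted forests with labels and subtree sizes\<close>

definition children :: "nat \<Rightarrow> (nat \<Rightarrow> nat) \<Rightarrow> nat \<Rightarrow> nat set" where
  "children n par v = {w. w < n \<and> par w = v \<and> w \<noteq> v}"

lemma finite_children [simp]: "finite (children n par v)"
  unfolding children_def by simp

text \<open>Labels are fixed only at roots; the edges carry them to the rest of the component. The
  bound on \<open>m\<close> serves twice: as a measure for walking towards the root, and later to
  turn congruences modulo p into equations.\<close>

definition forest_certificate ::
  "nat \<Rightarrow> (nat \<times> nat) list \<Rightarrow> (nat \<Rightarrow> nat) \<Rightarrow> (nat \<Rightarrow> nat) \<Rightarrow> (nat \<Rightarrow> nat) \<Rightarrow> bool" where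
  "forest_certificate n \<sigma> par c m \<longleftrightarrow>
     (\<forall>u<n. par u < n \<and> c u < n \<and> m u \<le> n) \<and>
     (\<forall>u<n. par u \<noteq> u \<longrightarrow> (u, par u) \<in> adj \<sigma>) \<and>
     (\<forall>u<n. par u = u \<longrightarrow> c u = u) \<and>
     (\<forall>(u, v)\<in>adj \<sigma>. c u = c v) \<and>
     (\<forall>v<n. m v = 1 + (\<Sum>w\<in>children n par v. m w))"

text \<open>The subtree sizes strictly increase along parent pointers, which rules out cycles.\<close>

lemma forest_certificate_num_components:
  assumes "forest_certificate n \<sigma> par c m"
  shows "num_components n \<sigma> = card {u. u < n \<and> par u = u}"
proof (rule num_components_eq_card)
  have par: "par u < n" if "u < n" for u using assms that by (simp add: forest_certificate_def)
  have edge: "(u, par u) \<in> adj \<sigma>" if "u < n" "par u \<noteq> u" for u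
    using assms that by (simp add: forest_certificate_def)
  have m_less: "m u < m (par u)" if "u < n" "par u \<noteq> u" for u
  proof -
    have "u \<in> children n par (par u)" using that by (simp add: children_def)
    then have "m u \<le> (\<Sum>w\<in>children n par (par u). m w)" by (intro member_le_sum) auto
    also have "\<dots> < m (par u)" using assms par[OF that(1)] by (simp add: forest_certificate_def)
    finally show ?thesis .
  qed
  have m_le: "m u \<le> n" if "u < n" for u using assms that unfolding forest_certificate_def by blast
  show "{u. u < n \<and> par u = u} \<subseteq> {0..<n}" by auto
  show "\<exists>r\<in>{u. u < n \<and> par u = u}. (u, r) \<in> (adj \<sigma>)\<^sup>*" if "u < n" for u
    using that
  proof (induction "n - m u" arbitrary: u rule: less_induct)
    case less
    show ?case
    proof (cases "par u = u")
      case True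
      with less.prems show ?thesis by blast
    next
      case False
      have "n - m (par u) < n - m u"
        using m_less[OF less.prems False] m_le[OF par[OF less.prems]] by linarith
      from less.hyps[OF this par[OF less.prems]]
      show ?thesis using edge[OF less.prems False] by (meson converse_rtrancl_into_rtrancl)
    qed
  qed
  \<comment> \<open>Labels are constant on components and a root is its own label, so connected
    roots coincide.\<close>
  have "c u = c v" if "(u, v) \<in> (adj \<sigma>)\<^sup>*" for u v
    using that by induction (use assms in \<open>auto simp: forest_certificate_def\<close>)
  then show "r = r'" if "r \<in> {u. u < n \<and> par u = u}" "r' \<in> {u. u < n \<and> par u = u}"
    "(r, r') \<in> (adj \<sigma>)\<^sup>*" for r r'
    using that assms by (auto simp: forest_certificate_def) metis
qed

text \<open>Take for \<open>m v\<close> the number of descendants of v, itself included. The rank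
  \<open>d\<close> falls along parent pointers, which excludes cycles and makes the descendants of
  different children disjoint.\<close>

lemma ex_subtree_sizes:
  fixes d :: "nat \<Rightarrow> nat"
  assumes par: "\<And>u. u < n \<Longrightarrow> par u < n"
    and d: "\<And>u. u < n \<Longrightarrow> par u \<noteq> u \<Longrightarrow> d (par u) < d u"
  shows "\<exists>m. \<forall>v<n. m v \<le> n \<and> m v = 1 + (\<Sum>w\<in>children n par v. m w)"
proof -
  define desc where "desc v = {w. w < n \<and> (\<exists>i. (par ^^ i) w = v)}" for v
  have fin: "finite (desc v)" for v unfolding desc_def by simp
  have iter: "(par ^^ i) u < n \<and> d ((par ^^ i) u) \<le> d u" if "u < n" for u i
    using that
  proof (induction i)
    case (Suc i)
    then show ?case using par[of "(par ^^ i) u"] d[of "(par ^^ i) u"]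
      by (cases "par ((par ^^ i) u) = (par ^^ i) u") auto
  qed simp
  have not_desc: "v \<notin> desc w" if "v < n" "w \<in> children n par v" for v w
  proof
    assume "v \<in> desc w"
    then have "d w \<le> d v" using iter[OF that(1)] by (auto simp: desc_def)
    moreover have "d v < d w" using that(2) d[of w] by (auto simp: children_def)
    ultimately show False by simp
  qed
  \<comment> \<open>If x meets w first and w' later, the path runs from w through its parent v to
    w', so v would descend from its own child w'.\<close>
  have shift: "False" if "v < n" "w' \<in> children n par v" "w \<in> children n par v"
    "(par ^^ i) x = w" "(par ^^ j) x = w'" "i < j" for v w w' x i j
  proof -
    have "j = (j - Suc i) + Suc i" using that by simp
    then have "(par ^^ j) x = (par ^^ (j - Suc i)) (par ((par ^^ i) x))"
      by (metis comp_apply funpow.simps(2) funpow_add)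
    then have "(par ^^ (j - Suc i)) v = w'" using that by (simp add: children_def)
    then show False using not_desc[OF that(1,2)] that(1) by (auto simp: desc_def)
  qed
  have disj: "desc w \<inter> desc w' = {}"
    if "v < n" "w \<in> children n par v" "w' \<in> children n par v" "w \<noteq> w'" for v w w'
  proof (rule ccontr)
    assume "desc w \<inter> desc w' \<noteq> {}"
    then obtain x i j where "(par ^^ i) x = w" "(par ^^ j) x = w'" by (auto simp: desc_def)
    then show False using shift[of v w' w i x j] shift[of v w w' j x i] that
      by (cases i j rule: linorder_cases) auto
  qed
  have desc_eq: "desc v = insert v (\<Union>w\<in>children n par v. desc w)" if v: "v < n" for v
  proof (intro equalityI subsetI)
    fix x assume "x \<in> desc v"
    then have x: "x < n" and "\<exists>i. (par ^^ i) x = v" by (auto simp: desc_def)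
    \<comment> \<open>First arrival at v: since \<open>par\<close> fixes a root, the predecessor at
      a later index could be v itself instead of a child.\<close>
    define i where "i = (LEAST i. (par ^^ i) x = v)"
    have i: "(par ^^ i) x = v" unfolding i_def by (rule LeastI_ex) fact
    show "x \<in> insert v (\<Union>w\<in>children n par v. desc w)"
    proof (cases i)
      case (Suc k)
      then have "(par ^^ k) x \<noteq> v" unfolding i_def using not_less_Least[of k "\<lambda>i. (par ^^ i) x = v"] by auto
      then have "(par ^^ k) x \<in> children n par v" using i Suc iter[OF x] by (simp add: children_def)
      then show ?thesis using x by (auto simp: desc_def)
    qed (use i in simp)
  next
    fix x assume "x \<in> insert v (\<Union>w\<in>children n par v. desc w)"
    then consider "x = v" | w where "w \<in> children n par v" "x \<in> desc w" by blast
    then show "x \<in> desc v"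
    proof cases
      case 1
      have "(par ^^ 0) v = v" by simp
      then show ?thesis unfolding 1 desc_def using v by blast
    next
      case 2
      then obtain i where "x < n" "(par ^^ i) x = w" by (auto simp: desc_def)
      then have "(par ^^ Suc i) x = v" using 2 by (simp add: children_def)
      then show ?thesis using \<open>x < n\<close> unfolding desc_def by blast
    qed
  qed
  have "card (desc v) \<le> n \<and> card (desc v) = 1 + (\<Sum>w\<in>children n par v. card (desc w))" if v: "v < n" for v
  proof
    have "desc v \<subseteq> {..<n}" by (auto simp: desc_def)
    then show "card (desc v) \<le> n" using card_mono[of "{..<n}" "desc v"] by simp
    have "v \<notin> (\<Union>w\<in>children n par v. desc w)" using not_desc[OF v] by blast
    then have "card (desc v) = Suc (card (\<Union>w\<in>children n par v. desc w))"
      using fin by (subst desc_eq[OF v]) simp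
    also have "card (\<Union>w\<in>children n par v. desc w) = (\<Sum>w\<in>children n par v. card (desc w))"
      using fin disj[OF v] by (intro card_UN_disjoint) auto
    finally show "card (desc v) = 1 + (\<Sum>w\<in>children n par v. card (desc w))" by simp
  qed
  then show ?thesis by (intro exI[of _ "\<lambda>v. card (desc v)"]) blast
qed

text \<open>A breadth-first forest: each component is rooted at its least vertex, \<open>d\<close>
  is the distance to it, and the parent is some closer neighbour. This distance is the rank that
  \<open>ex_subtree_sizes\<close> asks for.\<close>

lemma ex_forest_certificate:
  assumes valid: "valid_stream n \<sigma>"
  shows "\<exists>par c m. forest_certificate n \<sigma> par c m"
proof -
  define c where "c u = (LEAST v. (u, v) \<in> (adj \<sigma>)\<^sup>*)" for u
  define d where "d u = (LEAST k. (u, c u) \<in> (adj \<sigma>) ^^ k)" for u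
  have reach: "(u, c u) \<in> (adj \<sigma>)\<^sup>*" for u
    unfolding c_def by (rule LeastI[of _ u]) simp
  have c_eq: "c u = c v" if "(u, v) \<in> (adj \<sigma>)\<^sup>*" for u v
  proof -
    have "(v, u) \<in> (adj \<sigma>)\<^sup>*" using that sym_rtrancl[OF sym_adj] by (meson symD)
    then have "(u, w) \<in> (adj \<sigma>)\<^sup>* \<longleftrightarrow> (v, w) \<in> (adj \<sigma>)\<^sup>*" for w
      using that by (meson rtrancl_trans)
    then show ?thesis unfolding c_def by simp
  qed
  have d: "(u, c u) \<in> (adj \<sigma>) ^^ d u" for u
    unfolding d_def by (rule LeastI_ex) (use reach rtrancl_power in blast)
  have step: "\<exists>v. (u, v) \<in> adj \<sigma> \<and> d v < d u" if "c u \<noteq> u" for u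
  proof (cases "d u")
    case 0
    then show ?thesis using d[of u] that by simp
  next
    case (Suc k)
    then obtain v where v: "(u, v) \<in> adj \<sigma>" "(v, c u) \<in> (adj \<sigma>) ^^ k"
      using d[of u] by (metis relpow_Suc_E2)
    then have "c v = c u" using c_eq[OF r_into_rtrancl, of u v] by simp
    then have "d v \<le> k" using v unfolding d_def by (intro Least_le) simp
    with v Suc show ?thesis by auto
  qed
  define par where "par u = (if c u = u then u else SOME v. (u, v) \<in> adj \<sigma> \<and> d v < d u)" for u
  have par: "(u, par u) \<in> adj \<sigma> \<and> d (par u) < d u" if "c u \<noteq> u" for u
    unfolding par_def using someI_ex[OF step[OF that]] that by simp
  have par_root: "par u = u \<longleftrightarrow> c u = u" for u
    using par[of u] by (auto simp: par_def)
  have par_bound: "par u < n" if "u < n" for u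
    using that par[of u] adj_bound[OF valid, of u "par u"] par_root[of u] by (cases "c u = u") simp_all
  obtain m where m: "\<forall>v<n. m v \<le> n \<and> m v = 1 + (\<Sum>w\<in>children n par v. m w)"
    using ex_subtree_sizes[of n par d] par par_bound par_root by metis
  have "forest_certificate n \<sigma> par c m"
    unfolding forest_certificate_def
    using par par_root par_bound m c_eq rtrancl_adj_bound[OF valid reach] by blast
  then show ?thesis by blast
qed

section \<open>The score polynomial\<close>

lemma sum_adj:
  fixes F :: "nat \<Rightarrow> nat \<Rightarrow> int"
  assumes "valid_stream n \<sigma>"
  shows "(\<Sum>(u, v)\<in>adj \<sigma>. F u v) = (\<Sum>(u, v)\<leftarrow>\<sigma>. F u v + F v u)"
proof -
  have less: "u < v" if "(u, v) \<in> set \<sigma>" for u v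
    using assms that by (auto simp: valid_stream_def)
  have "set \<sigma> \<inter> (set \<sigma>)\<inverse> = {}" by (auto dest!: less)
  then have "(\<Sum>(u, v)\<in>adj \<sigma>. F u v) = (\<Sum>(u, v)\<in>set \<sigma>. F u v) + (\<Sum>(u, v)\<in>(set \<sigma>)\<inverse>. F u v)"
    unfolding adj_def by (intro sum.union_disjoint) auto
  also have "(\<Sum>(u, v)\<in>(set \<sigma>)\<inverse>. F u v) = (\<Sum>(u, v)\<in>set \<sigma>. F v u)"
    by (rule sum.reindex_bij_witness[of _ prod.swap prod.swap]) auto
  also have "(\<Sum>(u, v)\<in>set \<sigma>. F u v) + (\<Sum>(u, v)\<in>set \<sigma>. F v u) = (\<Sum>(u, v)\<in>set \<sigma>. F u v + F v u)"
    by (simp add: sum.distrib case_prod_unfold)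
  also have "\<dots> = (\<Sum>(u, v)\<leftarrow>\<sigma>. F u v + F v u)"
    using assms by (intro sum_list_distinct_conv_sum_set[symmetric]) (simp add: valid_stream_def)
  finally show ?thesis .
qed

lemma sum_adj_swap:
  fixes F :: "nat \<Rightarrow> nat \<Rightarrow> int"
  shows "(\<Sum>(u, v)\<in>adj \<sigma>. F u v) = (\<Sum>(u, v)\<in>adj \<sigma>. F v u)"
  by (rule sum.reindex_bij_witness[of _ prod.swap prod.swap]) (auto simp: adj_def)

text \<open>Summed over both orientations of an edge, \<open>c u ^ 2 - c u * c v\<close> contributes
  \<open>(c u - c v) ^ 2\<close>, so it penalises edges with differently labelled ends.\<close>

definition edge_score :: "(nat \<Rightarrow> nat) \<Rightarrow> (nat \<Rightarrow> nat) \<Rightarrow> nat \<Rightarrow> nat \<Rightarrow> int" where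
  "edge_score par c u v = of_bool (par u = v) - int (c u) ^ 2 + int (c u) * int (c v)"

text \<open>\<Delta> is the number of non-roots whose parent edge is absent plus half the sum of (c
  u - c v) ^ 2 over oriented edges. Neither part is negative, so \<Delta> = 0 forces both to vanish.
  The upper bound lets this be tested modulo a prime.\<close>

lemma edge_score_deficit:
  fixes par c :: "nat \<Rightarrow> nat"
  assumes valid: "valid_stream n \<sigma>" and c: "\<And>u. u < n \<Longrightarrow> c u < n"
  defines "k \<equiv> card {u. u < n \<and> par u = u}"
  defines "\<Delta> \<equiv> int n - int k - (\<Sum>(u, v)\<in>adj \<sigma>. edge_score par c u v)"
  shows "0 \<le> \<Delta>" and "\<Delta> \<le> int (n + n ^ 4)"
    and "\<Delta> = 0 \<longleftrightarrow> (\<forall>u<n. par u \<noteq> u \<longrightarrow> (u, par u) \<in> adj \<sigma>) \<and> (\<forall>(u, v)\<in>adj \<sigma>. c u = c v)"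
proof -
  let ?N = "{u. u < n \<and> par u \<noteq> u}" and ?P = "{u. u < n \<and> (u, par u) \<in> adj \<sigma>}"
  define pen where "pen = (\<Sum>(u, v)\<in>adj \<sigma>. int (c u) ^ 2 - int (c u) * int (c v))"
  have "n = card ({u. u < n \<and> par u = u} \<union> ?N)"
    by (subst card_Collect_less_nat[of n, symmetric]) (rule arg_cong[where f=card], auto)
  also have "\<dots> = k + card ?N" unfolding k_def by (intro card_Un_disjoint) auto
  finally have N: "int n - int k = int (card ?N)" by linarith
  have sub: "?P \<subseteq> ?N" by (auto dest: adj_bound[OF valid])
  have "(\<Sum>(u, v)\<in>adj \<sigma>. of_bool (par u = v) :: int) = (\<Sum>e\<in>{(u, v)\<in>adj \<sigma>. par u = v}. 1)"
    by (rule sum.mono_neutral_cong_right) auto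
  also have "\<dots> = (\<Sum>u\<in>?P. 1)"
    by (rule sum.reindex_bij_witness[of _ "\<lambda>u. (u, par u)" fst])
      (auto dest: adj_bound[OF valid])
  finally have P: "(\<Sum>(u, v)\<in>adj \<sigma>. of_bool (par u = v) :: int) = int (card ?P)" by simp
  have "(\<Sum>(u, v)\<in>adj \<sigma>. edge_score par c u v) = (\<Sum>(u, v)\<in>adj \<sigma>. of_bool (par u = v)) - pen"
    unfolding pen_def sum_subtractf[symmetric] by (rule sum.cong) (auto simp: edge_score_def)
  then have \<Delta>: "\<Delta> = (int (card ?N) - int (card ?P)) + pen"
    unfolding \<Delta>_def using N P by simp
  have "2 * pen = pen + (\<Sum>(u, v)\<in>adj \<sigma>. int (c v) ^ 2 - int (c v) * int (c u))"
    unfolding pen_def by (subst sum_adj_swap) simp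
  also have "\<dots> = (\<Sum>(u, v)\<in>adj \<sigma>. (int (c u) - int (c v)) ^ 2)"
    unfolding pen_def sum.distrib[symmetric]
    by (rule sum.cong) (auto simp: power2_eq_square algebra_simps)
  finally have pen: "2 * pen = (\<Sum>(u, v)\<in>adj \<sigma>. (int (c u) - int (c v)) ^ 2)" .
  have "0 \<le> 2 * pen" unfolding pen by (intro sum_nonneg) auto
  then have pen_nonneg: "0 \<le> pen" by simp
  have "pen = 0 \<longleftrightarrow> 2 * pen = 0" by simp
  also have "\<dots> \<longleftrightarrow> (\<forall>(u, v)\<in>adj \<sigma>. c u = c v)"
    unfolding pen by (subst sum_nonneg_eq_0_iff) auto
  finally have pen_0: "pen = 0 \<longleftrightarrow> (\<forall>(u, v)\<in>adj \<sigma>. c u = c v)" .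
  have "pen \<le> (\<Sum>(u, v)\<in>adj \<sigma>. int n ^ 2)"
    unfolding pen_def
  proof (rule sum_mono)
    fix e assume "e \<in> adj \<sigma>"
    moreover obtain u v where e: "e = (u, v)" by (cases e)
    ultimately have "c u < n" using adj_bound[OF valid] c by blast
    then have "int (c u) ^ 2 \<le> int n ^ 2" by (intro power_mono) auto
    moreover have "0 \<le> int (c u) * int (c v)" by simp
    ultimately show "(case e of (u, v) \<Rightarrow> int (c u) ^ 2 - int (c u) * int (c v)) \<le> (case e of (u, v) \<Rightarrow> int n ^ 2)"
      unfolding e prod.case by linarith
  qed
  also have "\<dots> = int (card (adj \<sigma>)) * int n ^ 2" by (simp add: case_prod_unfold)
  also have "\<dots> \<le> int (n * n) * int n ^ 2"
  proof -
    have "adj \<sigma> \<subseteq> {..<n} \<times> {..<n}" using adj_bound[OF valid] by auto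
    then have "card (adj \<sigma>) \<le> n * n"
      using card_mono[of "{..<n} \<times> {..<n}" "adj \<sigma>"] by (simp add: card_cartesian_product)
    then show ?thesis by (intro mult_right_mono) (auto simp del: of_nat_mult)
  qed
  also have "\<dots> = int (n ^ 4)" by (simp add: power_numeral_reduce)
  finally have pen_le: "pen \<le> int (n ^ 4)" .
  have P_le: "card ?P \<le> card ?N" by (rule card_mono[OF _ sub]) simp
  show "0 \<le> \<Delta>" unfolding \<Delta> using P_le pen_nonneg by simp
  have "card ?N \<le> n" using card_mono[of "{..<n}" ?N] by auto
  then show "\<Delta> \<le> int (n + n ^ 4)" unfolding \<Delta> using pen_le by simp
  have "\<Delta> = 0 \<longleftrightarrow> card ?P = card ?N \<and> pen = 0" unfolding \<Delta> using P_le pen_nonneg by linarith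
  also have "card ?P = card ?N \<longleftrightarrow> ?N \<subseteq> ?P"
  proof
    assume "card ?P = card ?N"
    then have "?P = ?N" by (intro card_subset_eq sub) simp_all
    then show "?N \<subseteq> ?P" by (rule equalityD2)
  next
    assume "?N \<subseteq> ?P"
    with sub show "card ?P = card ?N" by (intro arg_cong[where f=card] equalityI)
  qed
  also have "?N \<subseteq> ?P \<longleftrightarrow> (\<forall>u<n. par u \<noteq> u \<longrightarrow> (u, par u) \<in> adj \<sigma>)" by blast
  finally show "\<Delta> = 0 \<longleftrightarrow> (\<forall>u<n. par u \<noteq> u \<longrightarrow> (u, par u) \<in> adj \<sigma>) \<and> (\<forall>(u, v)\<in>adj \<sigma>. c u = c v)"
    unfolding pen_0 .
qed

text \<open>The size equation at v involves all children of v, whose tokens arrive scattered. As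
  coefficients of one polynomial the equations regroup by the child: vertex i contributes at the
  exponents i and \<open>par i\<close>, using its own token only.\<close>

lemma subtree_polynomial:
  fixes par m :: "nat \<Rightarrow> nat"
  assumes par: "\<And>i. i < n \<Longrightarrow> par i < n"
  defines "P \<equiv> (\<Sum>i<n. monom (int (m i)) i - monom 1 i - (if par i = i then 0 else monom (int (m i)) (par i)))"
  shows "degree P \<le> n"
    and "v < n \<Longrightarrow> coeff P v = int (m v) - 1 - (\<Sum>w\<in>children n par v. int (m w))"
    and "n \<le> v \<Longrightarrow> coeff P v = 0"
    and "poly P x = (\<Sum>i<n. int (m i) * x ^ i - x ^ i - (if par i = i then 0 else int (m i) * x ^ par i))"
proof -
  show zero: "coeff P v = 0" if "n \<le> v" for v
    unfolding P_def coeff_sum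
  proof (intro sum.neutral ballI)
    fix i assume "i \<in> {..<n}"
    with that par[of i] have "i \<noteq> v" "par i \<noteq> v" by auto
    then show "coeff (monom (int (m i)) i - monom 1 i -
        (if par i = i then 0 else monom (int (m i)) (par i))) v = 0" by simp
  qed
  show "degree P \<le> n" by (rule degree_le) (simp add: zero)
  show "poly P x = (\<Sum>i<n. int (m i) * x ^ i - x ^ i - (if par i = i then 0 else int (m i) * x ^ par i))"
    unfolding P_def poly_sum by (intro sum.cong) (auto simp: poly_monom)
  show "coeff P v = int (m v) - 1 - (\<Sum>w\<in>children n par v. int (m w))" if v: "v < n"
  proof -
    have "coeff P v = (\<Sum>i<n. (if i = v then int (m v) - 1 else 0) -
        (if i \<in> children n par v then int (m i) else 0))"
      unfolding P_def coeff_sum by (intro sum.cong) (auto simp: children_def)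
    also have "\<dots> = (int (m v) - 1) - (\<Sum>i<n. if i \<in> children n par v then int (m i) else 0)"
      using v by (simp add: sum_subtractf)
    also have "(\<Sum>i<n. if i \<in> children n par v then int (m i) else 0) = (\<Sum>w\<in>children n par v. int (m w))"
      by (rule sum.mono_neutral_cong_right) (auto simp: children_def)
    finally show ?thesis .
  qed
qed

section \<open>Exponents encoding the pairs (u, a)\<close>

lemma mult_add_unique:
  fixes x y a b k :: nat
  assumes "x + k * a = y + k * b" and "x < k" and "y < k"
  shows "x = y \<and> a = b"
  using arg_cong[OF assms(1), of "\<lambda>z. z mod k"] arg_cong[OF assms(1), of "\<lambda>z. z div k"] assms(2,3)
  by simp

locale grid =
  fixes n s t :: nat
  assumes s_pos: "0 < s" and t_pos: "0 < t" and n_eq: "t * s = n"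
begin

lemma n_pos: "0 < n" using s_pos t_pos n_eq by auto

lemma div_s_less: "v < n \<Longrightarrow> v div s < t"
  using less_mult_imp_div_less[of v t s] n_eq by simp

text \<open>In base 2 * n the digits are n - 1 and t - 1; \<open>row_exponent\<close> has digits u
  and a, \<open>corow_exponent\<close> the complementary ones. The base is 2 * n rather than n
  because two low digits add up to as much as 2 * n - 2 and must not carry.\<close>

definition centre :: nat where
  "centre = (n - 1) + 2 * n * (t - 1)"

definition row_exponent :: "nat \<Rightarrow> nat \<Rightarrow> nat" where
  "row_exponent u a = u + 2 * n * a"

definition corow_exponent :: "nat \<Rightarrow> nat \<Rightarrow> nat" where
  "corow_exponent u a = (n - 1 - u) + 2 * n * (t - 1 - a)"

lemma row_corow_exponent:
  "row_exponent u a + corow_exponent u' a' = (u + (n - 1 - u')) + 2 * n * (a + (t - 1 - a'))"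
  by (simp add: row_exponent_def corow_exponent_def add_mult_distrib2)

lemma exponent_eq_centre_iff:
  assumes "u < n" "u' < n" "a < t" "a' < t"
  shows "row_exponent u a + corow_exponent u' a' = centre \<longleftrightarrow> u = u' \<and> a = a'"
proof
  assume "row_exponent u a + corow_exponent u' a' = centre"
  then have eq: "(u + (n - 1 - u')) + 2 * n * (a + (t - 1 - a')) = (n - 1) + 2 * n * (t - 1)"
    by (simp only: row_corow_exponent centre_def)
  have "u + (n - 1 - u') < 2 * n" "n - 1 < 2 * n" using assms by linarith+
  then have "u + (n - 1 - u') = n - 1 \<and> a + (t - 1 - a') = t - 1"
    using mult_add_unique eq by blast
  then show "u = u' \<and> a = a'" using assms by linarith
next
  assume "u = u' \<and> a = a'"
  moreover have "u' + (n - 1 - u') = n - 1" "a' + (t - 1 - a') = t - 1" using assms by linarith+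
  ultimately show "row_exponent u a + corow_exponent u' a' = centre"
    by (simp only: row_corow_exponent centre_def)
qed

lemma exponent_less:
  assumes "u < n" "u' < n" "a < t" "a' < t"
  shows "row_exponent u a + corow_exponent u' a' < 4 * n * t"
proof -
  have "row_exponent u a + corow_exponent u' a' = (u + (n - 1 - u')) + 2 * n * (a + (t - 1 - a'))"
    by (rule row_corow_exponent)
  also have "\<dots> < 2 * n + 2 * n * (a + (t - 1 - a'))" using assms by linarith
  also have "\<dots> \<le> 2 * n + 2 * n * (2 * t - 2)" using assms by (intro add_left_mono mult_left_mono) linarith+
  also have "\<dots> \<le> 4 * n * t" using t_pos by (cases t) (auto simp: algebra_simps)
  finally show ?thesis .
qed

text \<open>The pair (u', a) is not tied to the edge, as the help-side factor is formed without
  knowledge of it. Only terms with u' = u and a = v div s reach \<open>centre\<close>; the residue v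
  mod s stays matched because it selects the product.\<close>

definition score_poly :: "(nat \<times> nat) list \<Rightarrow> (nat \<Rightarrow> nat) \<Rightarrow> (nat \<Rightarrow> nat) \<Rightarrow> int poly" where
  "score_poly \<sigma> par c = (\<Sum>(u, v)\<in>adj \<sigma>. \<Sum>u'<n. \<Sum>a<t.
     monom (edge_score par c u' (a * s + v mod s)) (row_exponent u (v div s) + corow_exponent u' a))"

lemma coeff_score_poly_centre:
  assumes "valid_stream n \<sigma>"
  shows "coeff (score_poly \<sigma> par c) centre = (\<Sum>(u, v)\<in>adj \<sigma>. edge_score par c u v)"
proof -
  have "coeff (\<Sum>u'<n. \<Sum>a<t. monom (edge_score par c u' (a * s + v mod s))
      (row_exponent u (v div s) + corow_exponent u' a)) centre = edge_score par c u v"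
    if "(u, v) \<in> adj \<sigma>" for u v
  proof -
    have uv: "u < n" "v div s < t" using adj_bound[OF assms that] div_s_less by auto
    have "coeff (\<Sum>u'<n. \<Sum>a<t. monom (edge_score par c u' (a * s + v mod s))
        (row_exponent u (v div s) + corow_exponent u' a)) centre
      = (\<Sum>u'<n. \<Sum>a<t. if a = v div s then (if u' = u then edge_score par c u v else 0) else 0)"
      unfolding coeff_sum by (intro sum.cong) (use uv exponent_eq_centre_iff in auto)
    also have "\<dots> = edge_score par c u v" using uv by simp
    finally show ?thesis .
  qed
  note inner = this
  show ?thesis
    unfolding score_poly_def coeff_sum[of _ "adj \<sigma>"]
  proof (rule sum.cong[OF refl])
    fix e assume e: "e \<in> adj \<sigma>"
    obtain u v where uv: "e = (u, v)" by (cases e)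
    show "coeff (case e of (u, v) \<Rightarrow> \<Sum>u'<n. \<Sum>a<t. monom (edge_score par c u' (a * s + v mod s))
        (row_exponent u (v div s) + corow_exponent u' a)) centre = (case e of (u, v) \<Rightarrow> edge_score par c u v)"
      unfolding uv prod.case by (rule inner) (use e uv in simp)
  qed
qed

lemma coeff_score_poly_eq_0:
  assumes "valid_stream n \<sigma>" and "4 * n * t \<le> i"
  shows "coeff (score_poly \<sigma> par c) i = 0"
  unfolding score_poly_def coeff_sum
proof (intro sum.neutral ballI)
  fix e assume e: "e \<in> adj \<sigma>"
  obtain u v where uv: "e = (u, v)" by (cases e)
  then have "u < n" "v div s < t" using adj_bound[OF assms(1)] e div_s_less by auto
  then have "row_exponent u (v div s) + corow_exponent u' a \<noteq> i" if "u' < n" "a < t" for u' a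
    using exponent_less[of u u' "v div s" a] that assms(2) by simp
  then show "coeff (case e of (u, v) \<Rightarrow> \<Sum>u'<n. \<Sum>a<t. monom (edge_score par c u' (a * s + v mod s))
      (row_exponent u (v div s) + corow_exponent u' a)) i = 0"
    unfolding uv prod.case coeff_sum by (intro sum.neutral ballI) simp
qed

lemma poly_score_poly_eq_sum:
  assumes "valid_stream n \<sigma>"
  shows "poly (score_poly \<sigma> par c) x = (\<Sum>i<4 * n * t. coeff (score_poly \<sigma> par c) i * x ^ i)"
proof -
  have "degree (score_poly \<sigma> par c) \<le> 4 * n * t - 1"
    using coeff_score_poly_eq_0[OF assms] by (intro degree_le) auto
  then have "poly (score_poly \<sigma> par c) x = (\<Sum>i\<le>4 * n * t - 1. coeff (score_poly \<sigma> par c) i * x ^ i)"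
    unfolding poly_altdef by (intro sum.mono_neutral_left) (auto simp: coeff_eq_0)
  also have "{..4 * n * t - 1} = {..<4 * n * t}" 
  proof -
    have "0 < 4 * n * t" using n_pos t_pos by simp
    then show ?thesis by (cases "4 * n * t") (auto simp: lessThan_Suc_atMost)
  qed
  finally show ?thesis .
qed

text \<open>Each of the four inner sums below can be maintained while reading either the edges or the
  pairs \<open>(par u, c u)\<close> in order, although \<open>edge_score\<close> involves the labels of two vertices.\<close>

lemma poly_score_poly:
  "poly (score_poly \<sigma> par c) x =
    (\<Sum>b<s. (\<Sum>(u, v)\<in>adj \<sigma>. if v mod s = b then x ^ row_exponent u (v div s) else 0) *
      ((\<Sum>u<n. \<Sum>a<t. x ^ corow_exponent u a * (of_bool (par u = a * s + b) - int (c u) ^ 2)) +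
       (\<Sum>u<n. int (c u) * x ^ (n - 1 - u)) *
       (\<Sum>v<n. if v mod s = b then int (c v) * x ^ (2 * n * (t - 1 - v div s)) else 0)))"
proof -
  define G where "G b = (\<Sum>u<n. \<Sum>a<t. edge_score par c u (a * s + b) * x ^ corow_exponent u a)" for b
  have "poly (score_poly \<sigma> par c) x = (\<Sum>(u, v)\<in>adj \<sigma>. x ^ row_exponent u (v div s) * G (v mod s))"
    unfolding score_poly_def poly_sum G_def
    by (intro sum.cong refl) (auto simp: poly_sum poly_monom sum_distrib_left power_add mult_ac)
  also have "\<dots> = (\<Sum>(u, v)\<in>adj \<sigma>. \<Sum>b<s. (if v mod s = b then x ^ row_exponent u (v div s) else 0) * G b)"
    by (intro sum.cong) (auto simp: s_pos if_distrib[of "\<lambda>y. y * _"] cong: if_cong)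
  also have "\<dots> = (\<Sum>b<s. (\<Sum>(u, v)\<in>adj \<sigma>. if v mod s = b then x ^ row_exponent u (v div s) else 0) * G b)"
    unfolding case_prod_unfold by (subst sum.swap) (simp add: sum_distrib_right)
  finally have main: "poly (score_poly \<sigma> par c) x = \<dots>" .
  have "G b = (\<Sum>u<n. \<Sum>a<t. x ^ corow_exponent u a * (of_bool (par u = a * s + b) - int (c u) ^ 2)) +
       (\<Sum>u<n. int (c u) * x ^ (n - 1 - u)) *
       (\<Sum>v<n. if v mod s = b then int (c v) * x ^ (2 * n * (t - 1 - v div s)) else 0)"
    if b: "b < s" for b
  proof -
    have "(\<Sum>v<n. if v mod s = b then int (c v) * x ^ (2 * n * (t - 1 - v div s)) else 0)
        = (\<Sum>v\<in>{v. v < n \<and> v mod s = b}. int (c v) * x ^ (2 * n * (t - 1 - v div s)))"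
      by (rule sum.mono_neutral_cong_right) auto
    also have "\<dots> = (\<Sum>a<t. int (c (a * s + b)) * x ^ (2 * n * (t - 1 - a)))"
    proof (rule sum.reindex_bij_witness[of _ "\<lambda>a. a * s + b" "\<lambda>v. v div s"])
      fix a assume "a \<in> {..<t}"
      then have "a * s + b < a * s + s" "Suc a * s \<le> t * s" using b by (simp, intro mult_right_mono) auto
      then show "a * s + b \<in> {v. v < n \<and> v mod s = b}" using b n_eq by simp
    qed (use b div_s_less in \<open>auto\<close>)
    finally have D: "(\<Sum>v<n. if v mod s = b then int (c v) * x ^ (2 * n * (t - 1 - v div s)) else 0)
        = (\<Sum>a<t. int (c (a * s + b)) * x ^ (2 * n * (t - 1 - a)))" .
    \<comment> \<open>\<open>corow_exponent u a\<close> is a part in u plus a part in a. Hence the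
      double sum over label products factors, and a single row sum serves all b.\<close>
    have "(\<Sum>u<n. int (c u) * x ^ (n - 1 - u)) *
       (\<Sum>v<n. if v mod s = b then int (c v) * x ^ (2 * n * (t - 1 - v div s)) else 0)
      = (\<Sum>u<n. \<Sum>a<t. int (c u) * int (c (a * s + b)) * x ^ corow_exponent u a)"
      unfolding D sum_product corow_exponent_def power_add by (intro sum.cong refl) (simp only: mult_ac)
    then show ?thesis
      unfolding G_def by (simp add: sum.distrib[symmetric] edge_score_def algebra_simps)
  qed
  then show ?thesis unfolding main by (intro sum.cong) auto
qed

end

section \<open>The scheme\<close>

text \<open>The indexed constructors are the inner sums of \<open>poly_score_poly\<close> that
  depend on b; \<open>Label_Row\<close> is the one that does not.\<close>

datatype reg = Graph nat | Score nat | Label_Column nat | Label_Row | Sizes | Roots | Faults | Claim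

lemma sum_lessThan_add:
  fixes f :: "nat \<Rightarrow> int"
  shows "(\<Sum>i<a + b. f i) = (\<Sum>i<a. f i) + (\<Sum>i<b. f (a + i))"
  by (induction b) (simp_all add: add.assoc)

context grid
begin

text \<open>The stream shows each edge once while \<open>adj\<close> contains both orientations,
  hence the two summands.\<close>

fun edge_weight :: "reg \<Rightarrow> nat \<Rightarrow> nat \<times> nat \<Rightarrow> int" where
  "edge_weight (Graph b) r (u, v) =
     (if v mod s = b then int r ^ row_exponent u (v div s) else 0) +
     (if u mod s = b then int r ^ row_exponent v (u div s) else 0)"
| "edge_weight _ r e = 0"

text \<open>The guard b < s makes \<open>Score\<close> vanish outside \<open>registers\<close>;
  \<open>Label_Column\<close>, like \<open>Graph\<close>, does so by itself, a residue modulo s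
  being below s. \<open>Faults\<close> counts violations instead of raising a flag, so it too is a
  plain sum.\<close>

fun vertex_weight :: "reg \<Rightarrow> nat \<Rightarrow> nat \<Rightarrow> nat \<times> nat \<times> nat \<Rightarrow> int" where
  "vertex_weight (Score b) r i x = (if b < s then
     \<Sum>a<t. int r ^ corow_exponent i a * (of_bool (fst x = a * s + b) - int (fst (snd x)) ^ 2) else 0)"
| "vertex_weight (Label_Column b) r i x =
     (if i mod s = b then int (fst (snd x)) * int r ^ (2 * n * (t - 1 - i div s)) else 0)"
| "vertex_weight Label_Row r i x = int (fst (snd x)) * int r ^ (n - 1 - i)"
| "vertex_weight Sizes r i x = int (snd (snd x)) * int r ^ i - int r ^ i -
     (if fst x = i then 0 else int (snd (snd x)) * int r ^ fst x)"
| "vertex_weight Roots r i x = of_bool (fst x = i)"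
| "vertex_weight Faults r i x = of_bool (\<not> (fst x < n \<and> fst (snd x) < n \<and> snd (snd x) \<le> n \<and>
     (fst x = i \<longrightarrow> fst (snd x) = i)))"
| "vertex_weight _ r i x = 0"

text \<open>The coefficient at \<open>centre\<close> is never read: it is prescribed by \<open>verdict\<close>.\<close>

definition help_weight :: "reg \<Rightarrow> nat \<Rightarrow> nat \<Rightarrow> nat \<times> nat \<times> nat \<Rightarrow> int" where
  "help_weight j r i x = (if i < n then vertex_weight j r i x
     else if j = Claim \<and> i < n + 4 * n * t \<and> i - n \<noteq> centre then int (fst x) * int r ^ (i - n)
     else 0)"

text \<open>Registers are multiplied only here, after all input has been read; until then each is a
  running sum.\<close>

definition verdict :: "nat \<Rightarrow> nat \<Rightarrow> (reg \<Rightarrow> int) \<Rightarrow> nat option" where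
  "verdict p r g = (if g Faults = 0 \<and> g Sizes = 0 \<and>
      int p dvd (\<Sum>b<s. g (Graph b) * (g (Score b) + g Label_Row * g (Label_Column b)))
        - (g Claim + (int n - g Roots) * int r ^ centre)
    then Some (nat (g Roots)) else None)"

definition registers :: "reg set" where
  "registers = Graph ` {..<s} \<union> Score ` {..<s} \<union> Label_Column ` {..<s}
     \<union> {Label_Row, Sizes, Roots, Faults, Claim}"

lemma finite_registers: "finite registers"
  unfolding registers_def by simp

lemma card_registers: "card registers \<le> 3 * s + 5"
proof -
  have image: "card (f ` {..<s}) \<le> s" for f :: "nat \<Rightarrow> reg"
    using card_image_le[of "{..<s}" f] by simp
  have "card {Label_Row, Sizes, Roots, Faults, Claim} = 5" by simp
  then show ?thesis
    unfolding registers_def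
    using card_Un_le[of "Graph ` {..<s} \<union> Score ` {..<s} \<union> Label_Column ` {..<s}"
        "{Label_Row, Sizes, Roots, Faults, Claim}"]
      card_Un_le[of "Graph ` {..<s} \<union> Score ` {..<s}" "Label_Column ` {..<s}"]
      card_Un_le[of "Graph ` {..<s}" "Score ` {..<s}"]
      image[of Graph] image[of Score] image[of Label_Column]
    by linarith
qed

lemma edge_weight_outside: "j \<notin> registers \<Longrightarrow> edge_weight j r e = 0"
  using s_pos by (cases j; cases e) (auto simp: registers_def)

lemma help_weight_outside: "j \<notin> registers \<Longrightarrow> help_weight j r i x = 0"
  using s_pos by (cases j; cases x) (auto simp: registers_def help_weight_def)

lemma help_weight_late: "n + 4 * n * t \<le> i \<Longrightarrow> help_weight j r i x = 0"
  by (simp add: help_weight_def)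

lemma sum_help_weight:
  assumes "n + 4 * n * t \<le> length \<tau>"
  shows "(\<Sum>i<length \<tau>. help_weight j r i (\<tau> ! i)) =
    (\<Sum>i<n. vertex_weight j r i (\<tau> ! i)) +
    (if j = Claim then \<Sum>i<4 * n * t. if i = centre then 0 else int (fst (\<tau> ! (n + i))) * int r ^ i else 0)"
proof -
  have "(\<Sum>i<length \<tau>. help_weight j r i (\<tau> ! i)) = (\<Sum>i<n + 4 * n * t. help_weight j r i (\<tau> ! i))"
    using assms by (intro sum.mono_neutral_right) (auto simp: help_weight_late)
  also have "\<dots> = (\<Sum>i<n. help_weight j r i (\<tau> ! i)) + (\<Sum>i<4 * n * t. help_weight j r (n + i) (\<tau> ! (n + i)))"
    by (rule sum_lessThan_add)
  also have "(\<Sum>i<n. help_weight j r i (\<tau> ! i)) = (\<Sum>i<n. vertex_weight j r i (\<tau> ! i))"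
    by (intro sum.cong) (auto simp: help_weight_def)
  also have "(\<Sum>i<4 * n * t. help_weight j r (n + i) (\<tau> ! (n + i))) =
      (if j = Claim then \<Sum>i<4 * n * t. if i = centre then 0 else int (fst (\<tau> ! (n + i))) * int r ^ i else 0)"
    by (auto simp: help_weight_def intro!: sum.cong)
  finally show ?thesis .
qed

section \<open>The meaning of the register contents\<close>

abbreviation parent :: "(nat \<times> nat \<times> nat) list \<Rightarrow> nat \<Rightarrow> nat" where
  "parent \<tau> i \<equiv> fst (\<tau> ! i)"

abbreviation label :: "(nat \<times> nat \<times> nat) list \<Rightarrow> nat \<Rightarrow> nat" where
  "label \<tau> i \<equiv> fst (snd (\<tau> ! i))"

abbreviation subtree_size :: "(nat \<times> nat \<times> nat) list \<Rightarrow> nat \<Rightarrow> nat" where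
  "subtree_size \<tau> i \<equiv> snd (snd (\<tau> ! i))"

definition root_count :: "(nat \<times> nat \<times> nat) list \<Rightarrow> nat" where
  "root_count \<tau> = card {u. u < n \<and> parent \<tau> u = u}"

definition faults :: "(nat \<times> nat \<times> nat) list \<Rightarrow> nat set" where
  "faults \<tau> = {i. i < n \<and> \<not> (parent \<tau> i < n \<and> label \<tau> i < n \<and> subtree_size \<tau> i \<le> n \<and>
     (parent \<tau> i = i \<longrightarrow> label \<tau> i = i))}"

definition size_balance :: "(nat \<times> nat \<times> nat) list \<Rightarrow> int \<Rightarrow> int" where
  "size_balance \<tau> x = (\<Sum>i<n. int (subtree_size \<tau> i) * x ^ i - x ^ i -
     (if parent \<tau> i = i then 0 else int (subtree_size \<tau> i) * x ^ parent \<tau> i))"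

text \<open>With the number of non-roots placed at \<open>centre\<close>, the assertion that the
  score has this value becomes part of an identity with \<open>score_poly\<close>.\<close>

definition claim_poly :: "(nat \<times> nat \<times> nat) list \<Rightarrow> int poly" where
  "claim_poly \<tau> = (\<Sum>i<4 * n * t.
     monom (if i = centre then int n - int (root_count \<tau>) else int (fst (\<tau> ! (n + i)))) i)"

lemma root_count_le: "root_count \<tau> \<le> n"
  unfolding root_count_def using card_mono[of "{..<n}" "{u. u < n \<and> parent \<tau> u = u}"] by auto

lemma centre_less: "centre < 4 * n * t"
  using exponent_less[of 0 0 0 0] exponent_eq_centre_iff[of 0 0 0 0] n_pos t_pos by simp

lemma coeff_claim_poly:
  "coeff (claim_poly \<tau>) i = (if 4 * n * t \<le> i then 0
     else if i = centre then int n - int (root_count \<tau>) else int (fst (\<tau> ! (n + i))))"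
  unfolding claim_poly_def coeff_sum by (simp add: sum.delta')

lemma poly_claim_poly:
  "poly (claim_poly \<tau>) x = (\<Sum>i<4 * n * t. if i = centre then 0 else int (fst (\<tau> ! (n + i))) * x ^ i)
     + (int n - int (root_count \<tau>)) * x ^ centre"
proof -
  have "poly (claim_poly \<tau>) x = (\<Sum>i<4 * n * t. (if i = centre then 0 else int (fst (\<tau> ! (n + i))) * x ^ i)
      + (if i = centre then (int n - int (root_count \<tau>)) * x ^ centre else 0))"
    unfolding claim_poly_def poly_sum by (intro sum.cong) (auto simp: poly_monom)
  also have "\<dots> = (\<Sum>i<4 * n * t. if i = centre then 0 else int (fst (\<tau> ! (n + i))) * x ^ i)
     + (int n - int (root_count \<tau>)) * x ^ centre"
    using centre_less by (simp add: sum.distrib)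
  finally show ?thesis .
qed

text \<open>\<open>Faults\<close> and \<open>Roots\<close> hold counts of at most n < p, so
  reduction leaves them exact; the remaining registers enter only through divisibility by p.\<close>

lemma verdict_register_value:
  assumes valid: "valid_stream n \<sigma>" and len: "n + 4 * n * t \<le> length \<tau>" and p: "n < p"
  shows "verdict p r (register_value p edge_weight help_weight r \<sigma> \<tau>) =
    (if faults \<tau> = {} \<and> int p dvd size_balance \<tau> (int r) \<and>
        int p dvd poly (score_poly \<sigma> (parent \<tau>) (label \<tau>) - claim_poly \<tau>) (int r)
     then Some (root_count \<tau>) else None)"
proof -
  define val where "val j = (\<Sum>e\<leftarrow>\<sigma>. edge_weight j r e) + (\<Sum>i<length \<tau>. help_weight j r i (\<tau> ! i))" for j
  define g where "g = register_value p edge_weight help_weight r \<sigma> \<tau>"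
  have g: "g j = val j mod int p" for j unfolding g_def register_value_def val_def ..
  have no_edge: "(\<Sum>e\<leftarrow>\<sigma>. edge_weight j r e) = 0" if "\<And>b. j \<noteq> Graph b" for j
    using that by (cases j) auto
  have Graph: "val (Graph b) = (\<Sum>(u, v)\<in>adj \<sigma>. if v mod s = b then int r ^ row_exponent u (v div s) else 0)" for b
  proof -
    have "val (Graph b) = (\<Sum>e\<leftarrow>\<sigma>. edge_weight (Graph b) r e)"
      unfolding val_def sum_help_weight[OF len] by simp
    also have "\<dots> = (\<Sum>(u, v)\<leftarrow>\<sigma>. (if v mod s = b then int r ^ row_exponent u (v div s) else 0) +
        (if u mod s = b then int r ^ row_exponent v (u div s) else 0))"
      by (intro arg_cong[where f=sum_list] map_cong) auto
    also have "\<dots> = (\<Sum>(u, v)\<in>adj \<sigma>. if v mod s = b then int r ^ row_exponent u (v div s) else 0)"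
      by (rule sum_adj[OF valid, symmetric])
    finally show ?thesis .
  qed
  have Score: "val (Score b) = (\<Sum>u<n. \<Sum>a<t. int r ^ corow_exponent u a *
      (of_bool (parent \<tau> u = a * s + b) - int (label \<tau> u) ^ 2))" if "b < s" for b
    unfolding val_def sum_help_weight[OF len] using that no_edge by simp
  have Label_Column: "val (Label_Column b) =
      (\<Sum>v<n. if v mod s = b then int (label \<tau> v) * int r ^ (2 * n * (t - 1 - v div s)) else 0)" for b
    unfolding val_def sum_help_weight[OF len] using no_edge by simp
  have Label_Row: "val Label_Row = (\<Sum>u<n. int (label \<tau> u) * int r ^ (n - 1 - u))"
    unfolding val_def sum_help_weight[OF len] using no_edge by simp
  have Sizes: "val Sizes = size_balance \<tau> (int r)"
    unfolding val_def sum_help_weight[OF len] size_balance_def using no_edge by simp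
  have count: "(\<Sum>i<n. of_bool (P i)) = int (card {i. i < n \<and> P i})" for P
  proof -
    have "(\<Sum>i<n. of_bool (P i) :: int) = (\<Sum>i\<in>{i. i < n \<and> P i}. 1)"
      by (rule sum.mono_neutral_cong_right) auto
    then show ?thesis by simp
  qed
  have Roots: "val Roots = int (root_count \<tau>)"
    unfolding val_def sum_help_weight[OF len] root_count_def using no_edge by (simp add: count)
  have Faults: "val Faults = int (card (faults \<tau>))"
    unfolding val_def sum_help_weight[OF len] faults_def using no_edge
    by (simp only: vertex_weight.simps count) simp
  have Claim: "val Claim = (\<Sum>i<4 * n * t. if i = centre then 0 else int (fst (\<tau> ! (n + i))) * int r ^ i)"
    unfolding val_def sum_help_weight[OF len] using no_edge by simp
  have "card (faults \<tau>) \<le> n"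
    using card_mono[of "{..<n}" "faults \<tau>"] by (auto simp: faults_def)
  then have "g Faults = int (card (faults \<tau>))" unfolding g Faults using p by simp
  moreover have "finite (faults \<tau>)" by (simp add: faults_def)
  ultimately have faults_iff: "g Faults = 0 \<longleftrightarrow> faults \<tau> = {}" by simp
  have sizes_iff: "g Sizes = 0 \<longleftrightarrow> int p dvd size_balance \<tau> (int r)"
    unfolding g Sizes by (rule mod_eq_0_iff_dvd)
  have roots: "g Roots = int (root_count \<tau>)"
    unfolding g Roots using root_count_le[of \<tau>] p by simp
  \<comment> \<open>The Verifier evaluates \<open>X\<close> at residues, the analysis at exact sums;
    a polynomial expression respects the congruence.\<close>
  define X where "X f = (\<Sum>b<s. f (Graph b) * (f (Score b) + f Label_Row * f (Label_Column b)))
        - (f Claim + (int n - f Roots) * int r ^ centre)" for f :: "reg \<Rightarrow> int"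
  have g_cong: "[g j = val j] (mod int p)" for j unfolding g cong_def by simp
  have "[X g = X val] (mod int p)"
    unfolding X_def by (intro cong_diff cong_sum cong_mult cong_add cong_refl g_cong)
  then have "int p dvd X g \<longleftrightarrow> int p dvd X val" by (rule cong_dvd_iff)
  also have "X val = poly (score_poly \<sigma> (parent \<tau>) (label \<tau>) - claim_poly \<tau>) (int r)"
    unfolding X_def poly_diff poly_score_poly poly_claim_poly Graph Label_Column Label_Row Roots Claim
    by (intro arg_cong2[where f="(-)"] refl sum.cong) (simp add: Score)
  finally have score_iff: "int p dvd X g \<longleftrightarrow> int p dvd poly (score_poly \<sigma> (parent \<tau>) (label \<tau>) - claim_poly \<tau>) (int r)" .
  have "verdict p r g = (if g Faults = 0 \<and> g Sizes = 0 \<and> int p dvd X g then Some (nat (g Roots)) else None)"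
    unfolding verdict_def X_def ..
  then show ?thesis unfolding faults_iff sizes_iff score_iff roots nat_int unfolding g_def .
qed

text \<open>A defect either is a fault, rejected for every seed, or leaves a coefficient nonzero
  modulo p, in the size polynomial or at \<open>centre\<close>, which at most n or 4 * n * t seeds
  miss. If nothing shows modulo p, the bounds on the data turn the congruences into equations, the
  certificate is genuine and an accepted root count is correct.\<close>

lemma verdict_sound:
  assumes valid: "valid_stream n \<sigma>" and len: "n + 4 * n * t \<le> length \<tau>"
    and p: "prime p" "16 * n ^ 4 < p"
  shows "3 * card {r\<in>{..<p}. verdict p r (register_value p edge_weight help_weight r \<sigma> \<tau>)
    \<notin> {None, Some (num_components n \<sigma>)}} \<le> p" (is "3 * card ?B \<le> p")
proof -
  have "n ^ 2 \<le> n ^ 4" using n_pos by (intro power_increasing) auto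
  then have n2: "n * n \<le> n ^ 4" by (simp add: power2_eq_square)
  have "n * 1 \<le> n * n" using n_pos by (intro mult_left_mono) auto
  then have n1: "n \<le> n ^ 4" using n2 by linarith
  have "t \<le> n" using s_pos n_eq[symmetric] by simp
  then have "n * t \<le> n * n" by (intro mult_left_mono) auto
  then have nt: "n * t \<le> n ^ 4" using n2 by linarith
  \<comment> \<open>The fourth power comes from the deficit bound n + n ^ 4; the factor 16 leaves
    room for 3 * (4 * n * t).\<close>
  have p_big: "n < p" "n + n ^ 4 < p" "n * n + n + 1 < p" "3 * (4 * n * t) \<le> p" "3 * n \<le> p"
    using p(2) n1 n2 nt n_pos by (linarith, linarith, linarith, simp, linarith)
  note verdict = verdict_register_value[OF valid len p_big(1)]
  let ?par = "parent \<tau>" and ?c = "label \<tau>" and ?m = "subtree_size \<tau>"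
  let ?D = "score_poly \<sigma> ?par ?c - claim_poly \<tau>"
  define P where "P = (\<Sum>i<n. monom (int (?m i)) i - monom 1 i -
      (if ?par i = i then 0 else monom (int (?m i)) (?par i)))"
  consider "faults \<tau> \<noteq> {}"
    | v where "faults \<tau> = {}" "\<not> int p dvd coeff P v"
    | "faults \<tau> = {}" "\<And>v. int p dvd coeff P v" "\<not> int p dvd coeff ?D centre"
    | "faults \<tau> = {}" "\<And>v. int p dvd coeff P v" "int p dvd coeff ?D centre"
    by blast
  then show ?thesis
  proof cases
    case 1
    then have "?B = {}" unfolding verdict by simp
    then show ?thesis by (simp only: card.empty)
  next
    case 2
    then have par: "?par i < n" if "i < n" for i using that by (auto simp: faults_def)
    have "size_balance \<tau> x = poly P x" for x
      unfolding P_def size_balance_def by (rule subtree_polynomial(4)[symmetric]) (rule par)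
    then have "?B \<subseteq> {r\<in>{..<p}. int p dvd poly P (int r)}"
      unfolding verdict by (auto split: if_splits)
    then have "card ?B \<le> card {r\<in>{..<p}. int p dvd poly P (int r)}" by (intro card_mono) auto
    also have "\<dots> \<le> n"
      by (rule card_roots_mod_prime_le[OF p(1) 2(2)]) (unfold P_def, rule subtree_polynomial(1), rule par)
    finally show ?thesis using p_big by linarith
  next
    case 3
    have "?B \<subseteq> {r\<in>{..<p}. int p dvd poly ?D (int r)}"
      unfolding verdict by (auto split: if_splits)
    then have "card ?B \<le> card {r\<in>{..<p}. int p dvd poly ?D (int r)}" by (intro card_mono) auto
    also have "\<dots> \<le> 4 * n * t"
    proof (rule card_roots_mod_prime_le[OF p(1) 3(3)], rule degree_le, intro allI impI)
      fix i assume "4 * n * t < i"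
      then show "coeff ?D i = 0" using coeff_score_poly_eq_0[OF valid] by (simp add: coeff_claim_poly)
    qed
    finally show ?thesis using p_big by linarith
  next
    case 4
    then have ok: "?par i < n" "?c i < n" "?m i \<le> n" "?par i = i \<longrightarrow> ?c i = i" if "i < n" for i
      using that by (auto simp: faults_def)
    have small: "x = 0" if "int p dvd x" "\<bar>x\<bar> < int p" for x
      using that zdvd_imp_le[of "int p" "\<bar>x\<bar>"] by fastforce
    define \<Delta> where "\<Delta> = int n - int (root_count \<tau>) - (\<Sum>(u, v)\<in>adj \<sigma>. edge_score ?par ?c u v)"
    have c: "\<forall>u. u < n \<longrightarrow> ?c u < n" using ok(2) by blast
    have deficit: "0 \<le> \<Delta>" "\<Delta> \<le> int (n + n ^ 4)"
      "\<Delta> = 0 \<longleftrightarrow> (\<forall>u<n. ?par u \<noteq> u \<longrightarrow> (u, ?par u) \<in> adj \<sigma>) \<and> (\<forall>(u, v)\<in>adj \<sigma>. ?c u = ?c v)"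
      unfolding \<Delta>_def root_count_def by (rule edge_score_deficit[OF valid]; simp add: c)+
    have "coeff ?D centre = - \<Delta>"
      using centre_less by (simp add: \<Delta>_def coeff_score_poly_centre[OF valid] coeff_claim_poly)
    then have "int p dvd \<Delta>" using 4(3) by (simp only: dvd_minus_iff)
    moreover have "int (n + n ^ 4) < int p" using p_big(2) by (simp only: of_nat_less_iff)
    then have "\<bar>\<Delta>\<bar> < int p" using deficit(1,2) by linarith
    ultimately have "\<Delta> = 0" by (rule small)
    then have edges: "\<forall>u<n. ?par u \<noteq> u \<longrightarrow> (u, ?par u) \<in> adj \<sigma>" "\<forall>(u, v)\<in>adj \<sigma>. ?c u = ?c v"
      using deficit(3) by blast+
    have sizes: "?m v = 1 + (\<Sum>w\<in>children n ?par v. ?m w)" if v: "v < n" for v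
    proof -
      have coeff: "coeff P v = int (?m v) - 1 - (\<Sum>w\<in>children n ?par v. int (?m w))"
        unfolding P_def by (rule subtree_polynomial(2)) (use ok v in auto)
      have "(\<Sum>w\<in>children n ?par v. ?m w) \<le> (\<Sum>w\<in>children n ?par v. n)"
        by (rule sum_mono) (auto simp: children_def ok)
      also have "\<dots> \<le> n * n"
        using card_mono[of "{..<n}" "children n ?par v"] by (auto simp: children_def)
      finally have "int (\<Sum>w\<in>children n ?par v. ?m w) \<le> int (n * n)" by (simp only: of_nat_le_iff)
      then have "(\<Sum>w\<in>children n ?par v. int (?m w)) \<le> int (n * n)" by simp
      moreover have "0 \<le> (\<Sum>w\<in>children n ?par v. int (?m w))" by (rule sum_nonneg) simp
      moreover have "int (n * n) + int n + 1 < int p" using p_big(3) by linarith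
      ultimately have "\<bar>coeff P v\<bar> < int p" unfolding coeff using ok(3)[OF v] by linarith
      then have "coeff P v = 0" by (rule small[OF 4(2)])
      then have "int (?m v) = int (1 + (\<Sum>w\<in>children n ?par v. ?m w))" unfolding coeff by simp
      then show ?thesis by (simp only: of_nat_eq_iff)
    qed
    have "forest_certificate n \<sigma> ?par ?c ?m"
      unfolding forest_certificate_def using ok edges sizes by blast
    then have "num_components n \<sigma> = root_count \<tau>"
      unfolding root_count_def by (rule forest_certificate_num_components)
    then have "?B = {}" unfolding verdict by simp
    then show ?thesis by (simp only: card.empty)
  qed
qed

section \<open>The honest Prover and completeness\<close>

definition honest_help :: "nat \<Rightarrow> (nat \<times> nat) list \<Rightarrow> (nat \<times> nat \<times> nat) list" where
  "honest_help p \<sigma> = (case (SOME (par, c, m). forest_certificate n \<sigma> par c m) of (par, c, m) \<Rightarrow>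
     map (\<lambda>i. (par i, c i, m i)) [0..<n] @
     map (\<lambda>i. (nat (coeff (score_poly \<sigma> par c) i mod int p), 0, 0)) [0..<4 * n * t])"

lemma honest_help:
  assumes valid: "valid_stream n \<sigma>" and p: "n < p"
  shows "length (honest_help p \<sigma>) = n + 4 * n * t"
    and "set (honest_help p \<sigma>) \<subseteq> {..<p} \<times> {..<p} \<times> {..<p}"
    and "verdict p r (register_value p edge_weight help_weight r \<sigma> (honest_help p \<sigma>))
      = Some (num_components n \<sigma>)"
proof -
  obtain par c m where eq: "(SOME (par, c, m). forest_certificate n \<sigma> par c m) = (par, c, m)"
    by (cases "SOME (par, c, m). forest_certificate n \<sigma> par c m")
  have "\<exists>x. case x of (par, c, m) \<Rightarrow> forest_certificate n \<sigma> par c m"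
    using ex_forest_certificate[OF valid] by auto
  from someI_ex[OF this] have cert: "forest_certificate n \<sigma> par c m" unfolding eq by simp
  let ?q = "\<lambda>i. nat (coeff (score_poly \<sigma> par c) i mod int p)"
  define \<tau> where "\<tau> = honest_help p \<sigma>"
  have \<tau>: "\<tau> = map (\<lambda>i. (par i, c i, m i)) [0..<n] @ map (\<lambda>i. (?q i, 0, 0)) [0..<4 * n * t]"
    unfolding \<tau>_def honest_help_def eq by simp
  have len: "length \<tau> = n + 4 * n * t" unfolding \<tau> by simp
  then show "length (honest_help p \<sigma>) = n + 4 * n * t" unfolding \<tau>_def .
  have bound: "par i < n" "c i < n" "m i \<le> n" "par i = i \<longrightarrow> c i = i" if "i < n" for i
    using cert that unfolding forest_certificate_def by blast+
  have q: "?q i < p" for i using p by (simp add: nat_less_iff)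
  have "(par i, c i, m i) \<in> {..<p} \<times> {..<p} \<times> {..<p}" if "i < n" for i
    using bound[OF that] p by simp
  then have "set \<tau> \<subseteq> {..<p} \<times> {..<p} \<times> {..<p}" unfolding \<tau> using q p by auto
  then show "set (honest_help p \<sigma>) \<subseteq> {..<p} \<times> {..<p} \<times> {..<p}" unfolding \<tau>_def .
  have vertex: "\<tau> ! i = (par i, c i, m i)" if "i < n" for i unfolding \<tau> using that by (simp add: nth_append)
  have coef: "\<tau> ! (n + i) = (?q i, 0, 0)" if "i < 4 * n * t" for i
    unfolding \<tau> using that by (simp add: nth_append)
  have roots: "root_count \<tau> = num_components n \<sigma>"
    unfolding forest_certificate_num_components[OF cert] root_count_def
    by (rule arg_cong[where f=card]) (auto simp: vertex)
  have faults: "faults \<tau> = {}"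
    unfolding faults_def using bound by (auto simp: vertex)
  have "size_balance \<tau> x = 0" for x
  proof -
    let ?P = "\<Sum>i<n. monom (int (m i)) i - monom 1 i - (if par i = i then 0 else monom (int (m i)) (par i))"
    have "coeff ?P v = 0" for v
    proof (cases "v < n")
      case True
      have "m v = 1 + (\<Sum>w\<in>children n par v. m w)"
        using cert True unfolding forest_certificate_def by blast
      then have "int (m v) = 1 + (\<Sum>w\<in>children n par v. int (m w))" by simp
      then show ?thesis using subtree_polynomial(2)[of n par v m] bound True by simp
    next
      case False
      then show ?thesis using subtree_polynomial(3)[of n par v m] bound by simp
    qed
    then have "?P = 0" by (intro poly_eqI) simp
    then have "poly ?P x = 0" by (simp only: poly_0)
    moreover have "poly ?P x = (\<Sum>i<n. int (m i) * x ^ i - x ^ i -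
        (if par i = i then 0 else int (m i) * x ^ par i))"
      by (rule subtree_polynomial(4)) (rule bound(1))
    moreover have "size_balance \<tau> x = \<dots>"
      unfolding size_balance_def by (intro sum.cong) (auto simp: vertex)
    ultimately show ?thesis by simp
  qed
  then have sizes: "int p dvd size_balance \<tau> (int r)" by simp
  \<comment> \<open>\<open>parent \<tau>\<close> and \<open>label \<tau>\<close> are known to agree
    with \<open>par\<close> and \<open>c\<close> only below n, so the polynomials are compared term
    by term.\<close>
  have score_eq: "score_poly \<sigma> (parent \<tau>) (label \<tau>) = score_poly \<sigma> par c"
  proof -
    have "edge_score (parent \<tau>) (label \<tau>) u' (a * s + v mod s) = edge_score par c u' (a * s + v mod s)"
      if "u' < n" "a < t" for u' a v
    proof -
      have "a * s + v mod s < a * s + s" "Suc a * s \<le> t * s"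
        using s_pos that by (simp, intro mult_right_mono) auto
      then have "a * s + v mod s < n" using n_eq by simp
      then show ?thesis using that by (simp add: edge_score_def vertex)
    qed
    then show ?thesis unfolding score_poly_def by (intro sum.cong refl) auto
  qed
  have "(\<Sum>(u, v)\<in>adj \<sigma>. edge_score par c u v) = int n - int (root_count \<tau>)"
    using edge_score_deficit(3)[OF valid, of c par, OF bound(2)] cert
    unfolding roots forest_certificate_num_components[OF cert] forest_certificate_def by simp
  then have centre: "coeff (score_poly \<sigma> par c) centre = int n - int (root_count \<tau>)"
    by (simp add: coeff_score_poly_centre[OF valid])
  have "int p dvd poly (score_poly \<sigma> par c - claim_poly \<tau>) (int r)"
  proof -
    have "[poly (claim_poly \<tau>) (int r) = poly (score_poly \<sigma> par c) (int r)] (mod int p)"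
      unfolding claim_poly_def poly_sum poly_monom poly_score_poly_eq_sum[OF valid]
    proof (intro cong_sum cong_mult cong_refl)
      fix i assume "i \<in> {..<4 * n * t}"
      then show "[(if i = centre then int n - int (root_count \<tau>) else int (fst (\<tau> ! (n + i))))
          = coeff (score_poly \<sigma> par c) i] (mod int p)"
        using centre p by (auto simp: coef cong_def)
    qed
    then show ?thesis by (simp add: cong_iff_dvd_diff dvd_diff_commute)
  qed
  then show "verdict p r (register_value p edge_weight help_weight r \<sigma> (honest_help p \<sigma>))
      = Some (num_components n \<sigma>)"
    unfolding \<tau>_def[symmetric] verdict_register_value[OF valid eq_imp_le[OF len[symmetric]] p] score_eq
    using faults sizes roots by simp
qed

text \<open>At most 3 * s + 5 registers, the seed and the counter make 3 * s + 7 blocks of b bits. A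
  token is a triple of numbers below p and takes 3 * b bits, both in the help and in the
  buffer.\<close>

lemma ex_scheme:
  assumes p: "prime p" "16 * n ^ 4 < p" "p \<le> 2 ^ b"
    and H: "real ((n + 4 * n * t) * (3 * b)) \<le> H" and S: "real (b * (3 * s + 7) + 3 * b) \<le> S"
  shows "\<exists>V. is_scheme n (num_components n) H S V"
proof -
  have "n ^ 1 \<le> n ^ 4" using n_pos by (intro power_increasing) auto
  then have n_less: "n < p" using p(2) by simp
  have "n * t * 1 \<le> n * t * s" using s_pos by (intro mult_left_mono) auto
  then have "n * t \<le> n ^ 2" using n_eq by (simp add: power2_eq_square mult.assoc)
  moreover have "n ^ 2 \<le> n ^ 4" using n_pos by (intro power_increasing) auto
  moreover have "n ^ 1 \<le> n ^ 4" using n_pos by (intro power_increasing) auto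
  ultimately have T: "n + 4 * n * t < p" using p(2) by simp
  have b: "b > 0" using p(3) prime_gt_1_nat[OF p(1)] by (cases b) auto
  show ?thesis
  proof (rule scheme_of_linear_registers[where J=registers and m="3 * s + 5" and p=p and b=b
        and T="n + 4 * n * t" and X="{..<p} \<times> {..<p} \<times> {..<p}" and w="3 * b" and a=edge_weight
        and h=help_weight and honest="honest_help p" and out="verdict p"])
    show "finite registers" "card registers \<le> 3 * s + 5" by (rule finite_registers card_registers)+
    show "n + 4 * n * t < p" "p \<le> 2 ^ b" by fact+
    show "finite ({..<p} \<times> {..<p} \<times> {..<p})" "{..<p} \<times> {..<p} \<times> {..<p} \<noteq> {}" using n_less by auto
    show "3 * b > 0" using b by simp
    have "card ({..<p} \<times> {..<p} \<times> {..<p}) = p ^ 3" by (simp add: card_cartesian_product power3_eq_cube)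
    also have "\<dots> \<le> (2 ^ b) ^ 3" using p(3) by (intro power_mono) auto
    also have "\<dots> = 2 ^ (3 * b)" by (simp add: power_mult[symmetric] mult.commute)
    finally show "card ({..<p} \<times> {..<p} \<times> {..<p}) \<le> 2 ^ (3 * b)" .
    show "real (b * (3 * s + 5 + 2) + 3 * b) \<le> S" using S by (simp add: algebra_simps)
  next
    fix \<sigma> assume \<sigma>: "valid_stream n \<sigma>"
    show "set (honest_help p \<sigma>) \<subseteq> {..<p} \<times> {..<p} \<times> {..<p} \<and> length (honest_help p \<sigma>) = n + 4 * n * t
        \<and> real (length (honest_help p \<sigma>) * (3 * b)) \<le> H"
      using honest_help(1,2)[OF \<sigma> n_less] H by simp
    show "verdict p r (register_value p edge_weight help_weight r \<sigma> (honest_help p \<sigma>))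
        = Some (num_components n \<sigma>)" for r
      by (rule honest_help(3)[OF \<sigma> n_less])
    show "3 * card {r\<in>{..<p}. verdict p r (register_value p edge_weight help_weight r \<sigma> \<tau>)
        \<notin> {None, Some (num_components n \<sigma>)}} \<le> p" if "n + 4 * n * t \<le> length \<tau>" for \<tau>
      by (rule verdict_sound[OF \<sigma> that p(1,2)])
  qed (fact edge_weight_outside help_weight_outside help_weight_late)+
qed

end

theorem theorem4p10:
  shows "\<exists>(C::real) (k::nat). \<forall>n t s :: nat. 0 < t \<and> 0 < s \<and> t * s = n \<longrightarrow>
    (\<exists>V. is_scheme n (num_components n)
          (C * real (n * t) * (log 2 (real n) + 2) ^ k)
          (C * real s * (log 2 (real n) + 2) ^ k) V)"
\<comment> \<open>One constant for both bounds: b is at most 10 * (log 2 n + 2), the help at most 15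
  * n * t * b bits and the space at most 13 * s * b bits.\<close>
proof (intro exI[of _ "150 :: real"] exI[of _ "1 :: nat"] allI impI)
  fix n t s :: nat assume "0 < t \<and> 0 < s \<and> t * s = n"
  then interpret grid n s t by unfold_locales auto
  define l where "l = nat \<lceil>log 2 (real n)\<rceil>"
  have log: "0 \<le> log 2 (real n)" using n_pos by simp
  then have "log 2 (real n) \<le> real l" and l: "real l \<le> log 2 (real n) + 1" unfolding l_def by linarith+
  then have "real n \<le> 2 powr real l" using n_pos by (simp add: log_le_iff)
  then have "real n \<le> real (2 ^ l)" by (simp add: powr_realpow)
  then have "n \<le> 2 ^ l" by (simp only: of_nat_le_iff)
  then have "n ^ 4 \<le> (2 ^ l) ^ 4" by (rule power_mono) simp
  then have "16 * n ^ 4 \<le> 2 ^ (4 * l + 4)" by (simp add: power_add power_mult[symmetric] mult.commute)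
  moreover obtain p :: nat where p: "prime p" "2 ^ (4 * l + 4) < p" "p \<le> 2 ^ (2 * (4 * l + 4) + 3)"
    using ex_prime_between_powers_of_two by blast
  ultimately have p_gt: "16 * n ^ 4 < p" by simp
  \<comment> \<open>The exponent in the upper bound on the prime, which itself lies above 2 ^ (4 * l
    + 4) \<ge> 16 * n ^ 4.\<close>
  define b where "b = 2 * (4 * l + 4) + 3"
  have "real b = 8 * real l + 11" unfolding b_def by simp
  with l log have b: "real b \<le> 10 * (log 2 (real n) + 2)" by simp
  have "n * 1 \<le> n * t" using t_pos by (intro mult_left_mono) auto
  then have "(n + 4 * n * t) * (3 * b) \<le> (5 * (n * t)) * (3 * b)" by (intro mult_right_mono) auto
  then have "real ((n + 4 * n * t) * (3 * b)) \<le> real (5 * (n * t) * (3 * b))" by (simp only: of_nat_le_iff)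
  also have "\<dots> = 15 * real (n * t) * real b" by simp
  also have "\<dots> \<le> 15 * real (n * t) * (10 * (log 2 (real n) + 2))" using b by (intro mult_left_mono) auto
  finally have H: "real ((n + 4 * n * t) * (3 * b)) \<le> 150 * real (n * t) * (log 2 (real n) + 2) ^ 1"
    by (simp add: algebra_simps)
  have "b * (3 * s + 7) + 3 * b = b * (3 * s + 10)" by (simp add: algebra_simps)
  also have "\<dots> \<le> b * (13 * s)" using s_pos by (intro mult_left_mono) auto
  finally have "real (b * (3 * s + 7) + 3 * b) \<le> real (b * (13 * s))" by (simp only: of_nat_le_iff)
  also have "\<dots> = 13 * real s * real b" by simp
  also have "\<dots> \<le> 15 * real s * (10 * (log 2 (real n) + 2))" using b by (intro mult_mono) auto
  finally have S: "real (b * (3 * s + 7) + 3 * b) \<le> 150 * real s * (log 2 (real n) + 2) ^ 1"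
    by (simp add: algebra_simps)
  show "\<exists>V. is_scheme n (num_components n) (150 * real (n * t) * (log 2 (real n) + 2) ^ 1)
      (150 * real s * (log 2 (real n) + 2) ^ 1) V"
    using p(3) by (intro ex_scheme[OF p(1) p_gt _ H S]) (simp only: b_def)
qed

end
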